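(* Let $P$ be a circuit partition of the 4-regular multigraph $F$, and let $C$ be an Euler system of $F$. (i) The nullspace of the relative interlacement matrix $\mathcal{I}_{P}(C)$ is spanned by the relative core vectors $\rho(\gamma,C)$ of the circuits $\gamma\in P$. (ii) For each connected component of $F$, the relative core vectors $\rho(\gamma,C)$ of the circuits $\gamma$ of $P$ incident on that component sum to $0$. (iii) If $Q\subset P$ and there is no connected component of $F$ for which $Q$ contains every incident circuit of $P$, then the relative core vectors $\rho(\gamma,C)$ of the circuits $\gamma\in Q$ are linearly independent.
   Context: Multigraphs are finite; in a 4-regular multigraph every vertex has degree 4, and loops and parallel edges are allowed (a loop contributes 2 to the degree of its vertex). Each edge consists of two half-edges, so exactly four half-edges are incident at each vertex. A transition at a vertex $v$ is one of the three ways to sort the four half-edges at $v$ into two disjoint pairs. A circuit is a closed walk with no repeated edge; circuits are considered without preferred starting point or orientation. Choosing one transition at each vertex of $F$ yields a partition of the edge set $E(F)$ into edge-disjoint circuits (consecutive half-edges of a circuit passing through a vertex are those paired by the chosen transition); such a partition, together with its transitions, is a circuit partition $P$ of $F$, and $P$ is said to involve the chosen transition at each vertex. An Euler system is a circuit partition containing exactly one circuit (an Euler circuit, containing every edge of the component) for each connected component of $F$. Interlacement: given an Euler system $C$, two vertices $v\neq w$ are interlaced with respect to $C$ if they appear in the order $v\ldots w\ldots v\ldots w$ on one of the circuits of $C$. The interlacement matrix $\mathcal{I}(C)$ is the $V(F)\times V(F)$ zero-diagonal symmetric matrix over $GF(2)$ whose $vw$ entry ($v\neq w$) is $1$ if and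 only if $v$ and $w$ are interlaced with respect to $C$. Transition labels with respect to $C$: at a vertex $v$, orient the circuit of $C$ incident at $v$ (either way). The transition followed by $C$ at $v$ is labeled $\phi$; the other transition in which in-directed half-edges are paired with out-directed half-edges is labeled $\chi$; the transition in which the two in-directed half-edges are paired with each other and the two out-directed half-edges are paired with each other is labeled $\psi$. Relative interlacement matrix: for a circuit partition $P$ and Euler system $C$ of $F$, $\mathcal{I}_P(C)$ is obtained from $\mathcal{I}(C)$ as follows. If $P$ involves the $\phi$ transition at $v$, change every nonzero entry of the row and column corresponding to $v$ to $0$, and change the diagonal entry of $v$ from $0$ to $1$. If $P$ involves the $\psi$ transition at $v$, change the diagonal entry of $v$ from $0$ to $1$. (No change on account of vertices where $P$ involves the $\chi$ transition.) Relative core vector: for $\gamma\in P$, $\rho(\gamma,C)\in GF(2)^{V(F)}$ is the vector whose nonzero entries correspond to the vertices $v$ at which $P$ involves either the $\chi$ or the $\psi$ transition (with respect to $C$) and $\gamma$ is singly incident, i.e. $\gamma$ includes precisely two of the four half-edges at $v$. In (iii), linear independence refers to the family $(\rho(\gamma,C))_{\gamma\in Q}$ indexed by $Q$. *)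

theory Defs
  imports "HOL-Analysis.Analysis" "HOL-Library.Z2" "HOL-Library.Disjoint_Sets"
begin

text \<open>
  A multigraph is given by its half-edges: \<open>vert F h\<close> is the vertex at which \<open>h\<close> is incident, and
  \<open>opp F h\<close> is the other half of the edge containing \<open>h\<close>. The vertex set is the whole (finite)
  type \<open>'v\<close>. Loops and parallel edges are allowed. The field \<open>GF(2)\<close> is the type \<open>bit\<close>.
\<close>

record ('v, 'h) multigraph =
  halves :: "'h set"
  vert :: "'h \<Rightarrow> 'v"
  opp :: "'h \<Rightarrow> 'h"

definition multigraph :: "('v::finite, 'h) multigraph \<Rightarrow> bool" where
  "multigraph F \<longleftrightarrow> finite (halves F) \<and>
     (\<forall>h\<in>halves F. opp F h \<in> halves F \<and> opp F h \<noteq> h \<and> opp F (opp F h) = h)"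

definition halves_at :: "('v, 'h) multigraph \<Rightarrow> 'v \<Rightarrow> 'h set" where
  "halves_at F v = {h \<in> halves F. vert F h = v}"

definition four_regular :: "('v::finite, 'h) multigraph \<Rightarrow> bool" where
  "four_regular F \<longleftrightarrow> multigraph F \<and> (\<forall>v. card (halves_at F v) = 4)"

definition full_edge :: "('v, 'h) multigraph \<Rightarrow> 'h \<Rightarrow> 'h set" where
  "full_edge F h = {h, opp F h}"

definition edges :: "('v, 'h) multigraph \<Rightarrow> 'h set set" where
  "edges F = full_edge F ` halves F"

definition adjacency :: "('v, 'h) multigraph \<Rightarrow> ('v \<times> 'v) set" where
  "adjacency F = {(vert F h, vert F (opp F h)) | h. h \<in> halves F}"

text \<open>Connected components are represented by their vertex sets.\<close>

definition graph_components :: "('v, 'h) multigraph \<Rightarrow> 'v set set" where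
  "graph_components F = UNIV // (adjacency F)\<^sup>*"

definition transitions :: "('v, 'h) multigraph \<Rightarrow> 'v \<Rightarrow> 'h set set set" where
  "transitions F v = {T. partition_on (halves_at F v) T \<and> (\<forall>p\<in>T. card p = 2)}"

text \<open>
  A closed walk without repeated edges is the cyclic list of the half-edges through which it leaves
  its successive vertices: its \<open>i\<close>-th edge is traversed from \<open>ws ! i\<close> to \<open>opp F (ws ! i)\<close>.
\<close>

definition closed_trail :: "('v, 'h) multigraph \<Rightarrow> 'h list \<Rightarrow> bool" where
  "closed_trail F ws \<longleftrightarrow> ws \<noteq> [] \<and> set ws \<subseteq> halves F \<and> distinct (map (full_edge F) ws) \<and>
     (\<forall>i<length ws. vert F (opp F (ws ! i)) = vert F (ws ! (Suc i mod length ws)))"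

text \<open>
  A circuit is the set of all closed walks that arise from one of them by moving the starting point
  and reversing the direction; its elements are the based oriented versions of the circuit.
\<close>

definition circuit_of :: "('v, 'h) multigraph \<Rightarrow> 'h list \<Rightarrow> 'h list set" where
  "circuit_of F ws = {rotate n ws | n. True} \<union> {rotate n (rev (map (opp F) ws)) | n. True}"

definition circuits :: "('v, 'h) multigraph \<Rightarrow> 'h list set set" where
  "circuits F = circuit_of F ` {ws. closed_trail F ws}"

text \<open>Both halves of every edge of \<open>\<gamma>\<close> occur here, as \<open>\<gamma>\<close> contains both orientations.\<close>

definition circuit_halves :: "'h list set \<Rightarrow> 'h set" where
  "circuit_halves \<gamma> = (\<Union>ws\<in>\<gamma>. set ws)"

definition circuit_edges :: "('v, 'h) multigraph \<Rightarrow> 'h list set \<Rightarrow> 'h set set" where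
  "circuit_edges F \<gamma> = full_edge F ` circuit_halves \<gamma>"

definition circuit_verts :: "('v, 'h) multigraph \<Rightarrow> 'h list set \<Rightarrow> 'v set" where
  "circuit_verts F \<gamma> = vert F ` circuit_halves \<gamma>"

text \<open>The pairs of consecutive half-edges with which \<open>\<gamma>\<close> passes through vertices.\<close>

definition circuit_passes :: "('v, 'h) multigraph \<Rightarrow> 'h list set \<Rightarrow> 'h set set" where
  "circuit_passes F \<gamma> =
     {{opp F (ws ! i), ws ! (Suc i mod length ws)} | ws i. ws \<in> \<gamma> \<and> i < length ws}"

text \<open>The transition involved at \<open>v\<close> in a collection \<open>P\<close> of circuits.\<close>

definition transition_at :: "('v, 'h) multigraph \<Rightarrow> 'h list set set \<Rightarrow> 'v \<Rightarrow> 'h set set" where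
  "transition_at F P v = {p \<in> (\<Union>\<gamma>\<in>P. circuit_passes F \<gamma>). p \<subseteq> halves_at F v}"

definition circuit_partition :: "('v, 'h) multigraph \<Rightarrow> 'h list set set \<Rightarrow> bool" where
  "circuit_partition F P \<longleftrightarrow> P \<subseteq> circuits F \<and>
     disjoint_family_on (circuit_edges F) P \<and> (\<Union>\<gamma>\<in>P. circuit_edges F \<gamma>) = edges F \<and>
     (\<forall>v. transition_at F P v \<in> transitions F v)"

definition incident_circuits ::
    "('v, 'h) multigraph \<Rightarrow> 'h list set set \<Rightarrow> 'v set \<Rightarrow> 'h list set set" where
  "incident_circuits F P K = {\<gamma> \<in> P. circuit_verts F \<gamma> \<inter> K \<noteq> {}}"

definition euler_system :: "('v, 'h) multigraph \<Rightarrow> 'h list set set \<Rightarrow> bool" where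
  "euler_system F C \<longleftrightarrow> circuit_partition F C \<and>
     (\<forall>K\<in>graph_components F. \<exists>!\<gamma>. \<gamma> \<in> incident_circuits F C K)"

text \<open>
  The starting point in the following definition is arbitrary since \<open>\<gamma>\<close> is closed under rotation.
\<close>

definition interlaced :: "('v, 'h) multigraph \<Rightarrow> 'h list set set \<Rightarrow> 'v \<Rightarrow> 'v \<Rightarrow> bool" where
  "interlaced F C v w \<longleftrightarrow> v \<noteq> w \<and>
     (\<exists>\<gamma>\<in>C. \<exists>ws\<in>\<gamma>. \<exists>i j k l. i < j \<and> j < k \<and> k < l \<and> l < length ws \<and>
        vert F (ws ! i) = v \<and> vert F (ws ! j) = w \<and> vert F (ws ! k) = v \<and> vert F (ws ! l) = w)"

definition interlacement_matrix ::
    "('v::finite, 'h) multigraph \<Rightarrow> 'h list set set \<Rightarrow> bit ^ 'v ^ 'v" where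
  "interlacement_matrix F C = (\<chi> v w. if interlaced F C v w then 1 else 0)"

text \<open>The half-edges at \<open>v\<close> directed into, respectively out of, \<open>v\<close> by the oriented walk \<open>ws\<close>.\<close>

definition in_halves :: "('v, 'h) multigraph \<Rightarrow> 'h list \<Rightarrow> 'v \<Rightarrow> 'h set" where
  "in_halves F ws v = {h \<in> opp F ` set ws. vert F h = v}"

definition out_halves :: "('v, 'h) multigraph \<Rightarrow> 'h list \<Rightarrow> 'v \<Rightarrow> 'h set" where
  "out_halves F ws v = {h \<in> set ws. vert F h = v}"

text \<open>
  The labels of a transition \<open>T\<close> at \<open>v\<close> with respect to the Euler system \<open>C\<close>. They do not depend on
  the chosen orientation \<open>ws\<close> of the circuit through \<open>v\<close>: reversal exchanges \<open>in_halves\<close> and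
  \<open>out_halves\<close>.
\<close>

definition phi_labeled ::
    "('v, 'h) multigraph \<Rightarrow> 'h list set set \<Rightarrow> 'v \<Rightarrow> 'h set set \<Rightarrow> bool" where
  "phi_labeled F C v T \<longleftrightarrow> T = transition_at F C v"

definition chi_labeled ::
    "('v, 'h) multigraph \<Rightarrow> 'h list set set \<Rightarrow> 'v \<Rightarrow> 'h set set \<Rightarrow> bool" where
  "chi_labeled F C v T \<longleftrightarrow> T \<in> transitions F v \<and> T \<noteq> transition_at F C v \<and>
     (\<exists>\<gamma>\<in>C. v \<in> circuit_verts F \<gamma> \<and>
        (\<exists>ws\<in>\<gamma>. \<forall>p\<in>T. \<exists>a\<in>in_halves F ws v. \<exists>b\<in>out_halves F ws v. p = {a, b}))"

definition psi_labeled ::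
    "('v, 'h) multigraph \<Rightarrow> 'h list set set \<Rightarrow> 'v \<Rightarrow> 'h set set \<Rightarrow> bool" where
  "psi_labeled F C v T \<longleftrightarrow> T \<in> transitions F v \<and>
     (\<exists>\<gamma>\<in>C. v \<in> circuit_verts F \<gamma> \<and>
        (\<exists>ws\<in>\<gamma>. T = {in_halves F ws v, out_halves F ws v}))"

definition relative_interlacement_matrix ::
    "('v::finite, 'h) multigraph \<Rightarrow> 'h list set set \<Rightarrow> 'h list set set \<Rightarrow> bit ^ 'v ^ 'v" where
  "relative_interlacement_matrix F P C =
     (\<chi> v w.
        if v = w then
          (if phi_labeled F C v (transition_at F P v) \<or> psi_labeled F C v (transition_at F P v)
           then 1 else interlacement_matrix F C $ v $ w)
        else
          (if phi_labeled F C v (transition_at F P v) \<or> phi_labeled F C w (transition_at F P w)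
           then 0 else interlacement_matrix F C $ v $ w))"

definition relative_core_vector ::
    "('v::finite, 'h) multigraph \<Rightarrow> 'h list set set \<Rightarrow> 'h list set set \<Rightarrow> 'h list set \<Rightarrow> bit ^ 'v" where
  "relative_core_vector F P C \<gamma> =
     (\<chi> v.
        if (chi_labeled F C v (transition_at F P v) \<or> psi_labeled F C v (transition_at F P v)) \<and>
           card (circuit_halves \<gamma> \<inter> halves_at F v) = 2
        then 1 else 0)"

end

theory Submission
  imports Defs
begin

text \<open>
  The proof replaces vectors by edge labellings with values in \<open>GF(2)\<close>. Such a labelling is said to
  jump by \<open>x\<close> along a circuit partition if its value changes by \<open>x $ v\<close> whenever a circuit passes
  through \<open>v\<close>.

  Along the Euler system \<open>C\<close>, every \<open>x\<close> is the jump vector of some labelling \<open>f\<close> (\<open>jumps_exist\<close>): an Euler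
  circuit visits each of its vertices twice, so the jumps cancel when it closes. Let \<open>a\<close>, \<open>c\<close> be the
  half-edges by which the Euler circuit enters \<open>v\<close> and \<open>b\<close>, \<open>d\<close> those by which it leaves after \<open>a\<close>, \<open>c\<close>.
  Then \<open>f b = f a + x $ v\<close> and \<open>f d = f c + x $ v\<close>. Moreover, on the way from \<open>b\<close> to \<open>c\<close> the entries at
  vertices met twice cancel, and the vertices met once are those interlaced with \<open>v\<close>; hence
  \<open>f c = f b + (\<I>(C) x) $ v\<close> (\<open>tour_jumps\<close>). If \<open>x\<close> vanishes where \<open>P\<close> follows \<open>C\<close>, the \<open>v\<close>-th entry of
  \<open>\<I>\<^sub>P(C) x\<close> is therefore \<open>f b + f c\<close> at a \<open>\<chi>\<close> vertex, where \<open>P\<close> pairs \<open>a\<close> with \<open>d\<close> and \<open>b\<close> with \<open>c\<close>, and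
  \<open>f a + f c\<close> at a \<open>\<psi>\<close> vertex, where \<open>P\<close> pairs \<open>a\<close> with \<open>c\<close> and \<open>b\<close> with \<open>d\<close>. In both cases it vanishes if and
  only if \<open>f\<close> is constant on the pairs of \<open>P\<close> at \<open>v\<close> (\<open>row_eq_0_iff\<close>). So \<open>x\<close> is in the nullspace if and
  only if \<open>f\<close> is constant on every circuit of \<open>P\<close>, that is, given by one coefficient per circuit.

  Conversely, the labelling given by coefficients \<open>c \<gamma>\<close> has as jump vector along \<open>C\<close> the combination
  of the relative core vectors with these coefficients (\<open>core_combination\<close>). This proves the claim about
  the nullspace. It also shows that a linear relation among core vectors is the same as a labelling that
  is constant on the circuits of \<open>P\<close> and on those of \<open>C\<close>, that is, on the components of the graph. The
  indicator of a component gives the sum that is \<open>0\<close>, and a relation that involves some circuit of a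
  component involves all of them.
\<close>


section \<open>Arithmetic modulo two\<close>

lemma bit_add_self: "a + a = (0::bit)"
  by (cases a) auto

lemma bit_add_eq_0_iff: "a + b = 0 \<longleftrightarrow> a = (b::bit)"
  by (cases a; cases b) auto

lemma of_nat_bit: "(of_nat n :: bit) = of_bool (odd n)"
  by (induction n) auto

lemma sum_bit_by_fibres:
  fixes g :: "'v::finite \<Rightarrow> bit"
  assumes "finite A"
  shows "(\<Sum>m\<in>A. g (u m)) = (\<Sum>w\<in>UNIV. of_bool (odd (card {m\<in>A. u m = w})) * g w)"
proof -
  have "(\<Sum>m\<in>A. g (u m)) = (\<Sum>w\<in>UNIV. \<Sum>m\<in>{m\<in>A. u m = w}. g (u m))"
    by (rule sum.group[symmetric]) (use assms in auto)
  also have "\<dots> = (\<Sum>w\<in>UNIV. of_bool (odd (card {m\<in>A. u m = w})) * g w)"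
  proof (rule sum.cong[OF refl])
    fix w
    have "(\<Sum>m\<in>{m\<in>A. u m = w}. g (u m)) = (\<Sum>m\<in>{m\<in>A. u m = w}. g w)"
      by (rule sum.cong) auto
    then show "(\<Sum>m\<in>{m\<in>A. u m = w}. g (u m)) = of_bool (odd (card {m\<in>A. u m = w})) * g w"
      by (simp add: of_nat_bit)
  qed
  finally show ?thesis .
qed

(* Sums and products in GF(2) are to stay in ring notation, not to turn into bitwise operations. *)
declare add_bit_eq_xor [simp del] mult_bit_eq_and [simp del]


section \<open>Alternation in cyclic lists\<close>

text \<open>
  Two letters alternate in a list if one of the patterns \<open>vwvw\<close>, \<open>wvwv\<close> occurs. Unlike either
  pattern alone, this is a property of the list up to rotation and reversal.
\<close>

definition alternating :: "'a list \<Rightarrow> 'a \<Rightarrow> 'a \<Rightarrow> bool" where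
  "alternating xs v w \<longleftrightarrow> (\<exists>a b i j k l. {a, b} = {v, w} \<and> i < j \<and> j < k \<and> k < l \<and> l < length xs \<and>
     xs ! i = a \<and> xs ! j = b \<and> xs ! k = a \<and> xs ! l = b)"

lemma alternatingI:
  assumes "{a, b} = {v, w}" "i < j" "j < k" "k < l" "l < length xs"
    "xs ! i = a" "xs ! j = b" "xs ! k = a" "xs ! l = b"
  shows "alternating xs v w"
  unfolding alternating_def using assms by blast

lemma alternating_rotate1:
  assumes "alternating xs v w"
  shows "alternating (rotate1 xs) v w"
proof -
  obtain a b i j k l where *: "{a, b} = {v, w}" "i < j" "j < k" "k < l" "l < length xs"
     "xs ! i = a" "xs ! j = b" "xs ! k = a" "xs ! l = b"
    using assms unfolding alternating_def by blast
  have shift: "rotate1 xs ! (m - 1) = xs ! m" if "0 < m" "m < length xs" for m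
    using that by (simp add: nth_rotate1)
  show ?thesis
  proof (cases "i = 0")
    case False
    show ?thesis
      by (rule alternatingI[of a b v w "i - 1" "j - 1" "k - 1" "l - 1"])
        (use * False in \<open>auto simp: shift simp del: One_nat_def\<close>)
  next
    case True
    have "Suc (length xs - 1) = length xs" "length xs - 1 < length xs"
      using * by simp_all
    then have "rotate1 xs ! (length xs - 1) = xs ! 0"
      using nth_rotate1[of "length xs - 1" xs] by simp
    then show ?thesis
      by (intro alternatingI[of b a v w "j - 1" "k - 1" "l - 1" "length xs - 1"])
        (use * True in \<open>auto simp: shift simp del: One_nat_def\<close>)
  qed
qed

lemma alternating_rotate: "alternating (rotate n xs) v w \<longleftrightarrow> alternating xs v w"
proof -
  have imp: "alternating xs v w \<Longrightarrow> alternating (rotate n xs) v w" for n and xs :: "'a list"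
    by (induction n) (auto intro: alternating_rotate1)
  moreover have "alternating xs v w" if "alternating (rotate n xs) v w"
  proof -
    let ?m = "length xs - n mod length xs"
    have "rotate ?m (rotate n xs) = xs"
    proof (cases "xs = []")
      case False
      have "(?m + n) mod length xs = (?m + n mod length xs) mod length xs"
        by (rule mod_add_right_eq[symmetric])
      also have "?m + n mod length xs = length xs"
        using False by (simp add: less_imp_le)
      finally show ?thesis
        by (simp add: rotate_rotate rotate_id)
    qed simp
    then show ?thesis using imp[OF that, of ?m] by simp
  qed
  ultimately show ?thesis by blast
qed

lemma alternating_rev: "alternating (rev xs) v w \<longleftrightarrow> alternating xs v w"
proof -
  have "alternating (rev xs) v w" if alt: "alternating xs v w" for xs :: "'a list"
  proof -
    obtain a b i j k l where *: "{a, b} = {v, w}" "i < j" "j < k" "k < l" "l < length xs"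
       "xs ! i = a" "xs ! j = b" "xs ! k = a" "xs ! l = b"
      using alt unfolding alternating_def by blast
    have flip: "rev xs ! (length xs - Suc m) = xs ! m" if "m < length xs" for m
      using that by (simp add: rev_nth)
    show ?thesis
      by (rule alternatingI[of b a v w "length xs - Suc l" "length xs - Suc k"
            "length xs - Suc j" "length xs - Suc i"]) (use * in \<open>auto simp: flip\<close>)
  qed
  from this[of xs] this[of "rev xs"] show ?thesis by auto
qed


section \<open>Closed trails and circuits\<close>

lemma multigraph_opp:
  assumes "multigraph F" "h \<in> halves F"
  shows "opp F h \<in> halves F" "opp F h \<noteq> h" "opp F (opp F h) = h"
  using assms unfolding multigraph_def by auto

lemma opp_image_opp:
  assumes "multigraph F" "A \<subseteq> halves F"
  shows "opp F ` opp F ` A = A"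
proof -
  have "(\<lambda>h. opp F (opp F h)) ` A = (\<lambda>h. h) ` A"
    using assms by (intro image_cong) (auto simp: multigraph_opp(3))
  then show ?thesis by (simp add: image_image)
qed

lemma full_edge_eq_iff:
  assumes "multigraph F" "h \<in> halves F" "h' \<in> halves F"
  shows "full_edge F h = full_edge F h' \<longleftrightarrow> h' = h \<or> h' = opp F h"
  using multigraph_opp[OF assms(1,2)] multigraph_opp[OF assms(1,3)]
  unfolding full_edge_def doubleton_eq_iff by auto

lemma full_edge_opp:
  assumes "multigraph F" "h \<in> halves F"
  shows "full_edge F (opp F h) = full_edge F h"
  using multigraph_opp[OF assms] unfolding full_edge_def by auto

lemma closed_trail_nth_in:
  assumes "closed_trail F ws" "i < length ws"
  shows "ws ! i \<in> halves F"
  using assms unfolding closed_trail_def by auto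

lemma closed_trail_step:
  assumes "closed_trail F ws" "i < length ws"
  shows "vert F (opp F (ws ! i)) = vert F (ws ! (Suc i mod length ws))"
  using assms unfolding closed_trail_def by auto

lemma closed_trail_edge_inj:
  assumes "closed_trail F ws" "i < length ws" "j < length ws"
    "full_edge F (ws ! i) = full_edge F (ws ! j)"
  shows "i = j"
  using assms nth_eq_iff_index_eq[of "map (full_edge F) ws" i j]
  unfolding closed_trail_def by auto

lemma closed_trail_opp_notin:
  assumes "multigraph F" "closed_trail F ws" "h \<in> set ws"
  shows "opp F h \<notin> set ws"
proof
  assume "opp F h \<in> set ws"
  then obtain i j where ij: "i < length ws" "ws ! i = h" "j < length ws" "ws ! j = opp F h"
    using assms(3) by (auto simp: in_set_conv_nth)
  have h: "h \<in> halves F"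
    using closed_trail_nth_in[OF assms(2) ij(1)] ij(2) by simp
  have "i = j"
    by (rule closed_trail_edge_inj[OF assms(2)]) (use ij full_edge_opp[OF assms(1) h] in auto)
  then show False
    using ij multigraph_opp[OF assms(1) h] by auto
qed

lemma closed_trail_rotate:
  assumes "closed_trail F ws"
  shows "closed_trail F (rotate n ws)"
  unfolding closed_trail_def
proof (intro conjI allI impI)
  show "rotate n ws \<noteq> []" "set (rotate n ws) \<subseteq> halves F"
    using assms unfolding closed_trail_def by auto
  show "distinct (map (full_edge F) (rotate n ws))"
    using assms unfolding closed_trail_def by (simp flip: rotate_map)
next
  fix i assume i: "i < length (rotate n ws)"
  then have "ws \<noteq> []" by auto
  then have lt: "(n + i) mod length ws < length ws" by simp
  have "Suc ((n + i) mod length ws) mod length ws = (n + Suc i mod length ws) mod length ws"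
    by (simp add: mod_simps)
  then show "vert F (opp F (rotate n ws ! i)) =
      vert F (rotate n ws ! (Suc i mod length (rotate n ws)))"
    using closed_trail_step[OF assms lt] i \<open>ws \<noteq> []\<close> by (simp add: nth_rotate)
qed

lemma closed_trail_reverse:
  assumes "multigraph F" "closed_trail F ws"
  shows "closed_trail F (rev (map (opp F) ws))"
  unfolding closed_trail_def
proof (intro conjI allI impI)
  have sub: "set ws \<subseteq> halves F" using assms(2) unfolding closed_trail_def by auto
  show "rev (map (opp F) ws) \<noteq> []" "set (rev (map (opp F) ws)) \<subseteq> halves F"
    using assms sub unfolding closed_trail_def by (auto simp: multigraph_opp)
  have "map (full_edge F) (rev (map (opp F) ws)) = rev (map (full_edge F) ws)"
    using sub by (auto simp: rev_map full_edge_opp[OF assms(1)])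
  then show "distinct (map (full_edge F) (rev (map (opp F) ws)))"
    using assms(2) unfolding closed_trail_def by simp
next
  fix i assume "i < length (rev (map (opp F) ws))"
  then have i: "i < length ws" by simp
  have nth: "rev (map (opp F) ws) ! j = opp F (ws ! (length ws - Suc j))" if "j < length ws" for j
    using that by (simp add: rev_nth)
  have lhs: "vert F (opp F (rev (map (opp F) ws) ! i)) = vert F (ws ! (length ws - Suc i))"
    using i closed_trail_nth_in[OF assms(2)] by (simp add: nth multigraph_opp[OF assms(1)])
  show "vert F (opp F (rev (map (opp F) ws) ! i)) =
      vert F (rev (map (opp F) ws) ! (Suc i mod length (rev (map (opp F) ws))))"
  proof (cases "Suc i = length ws")
    case True
    then have "i = length ws - 1" "0 < length ws" by auto
    then show ?thesis
      using lhs nth[of 0] closed_trail_step[OF assms(2), of "length ws - 1"] by simp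
  next
    case False
    then have "Suc i < length ws" using i by simp
    then show ?thesis
      using lhs nth[of "Suc i"] closed_trail_step[OF assms(2), of "length ws - Suc (Suc i)"]
      by (auto simp: Suc_diff_Suc)
  qed
qed

lemma closed_trail_heads:
  assumes "closed_trail F ws"
  shows "map (\<lambda>h. vert F (opp F h)) ws = rotate1 (map (vert F) ws)"
proof (rule nth_equalityI)
  fix i assume "i < length (map (\<lambda>h. vert F (opp F h)) ws)"
  moreover from this have "Suc i mod length ws < length ws"
    by (intro mod_less_divisor) auto
  ultimately show "map (\<lambda>h. vert F (opp F h)) ws ! i = rotate1 (map (vert F) ws) ! i"
    using closed_trail_step[OF assms, of i] by (simp add: nth_rotate1)
qed simp

text \<open>
  Every element of a circuit represents it: whatever is invariant under rotation and reversal can be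
  read off any of them.
\<close>

lemma circuit_element:
  assumes "multigraph F" "\<gamma> \<in> circuits F"
  shows "\<exists>ws0. closed_trail F ws0 \<and> ws0 \<in> \<gamma> \<and>
    (\<forall>ws\<in>\<gamma>. (\<exists>n. ws = rotate n ws0) \<or> (\<exists>n. ws = rotate n (rev (map (opp F) ws0)))) \<and>
    (\<forall>n. rotate n ws0 \<in> \<gamma>) \<and> (\<forall>n. rotate n (rev (map (opp F) ws0)) \<in> \<gamma>)"
proof -
  obtain ws0 where ws0: "closed_trail F ws0" "\<gamma> = circuit_of F ws0"
    using assms unfolding circuits_def by auto
  have "ws0 = rotate 0 ws0" by simp
  then show ?thesis
    using ws0 unfolding circuit_of_def by blast
qed

lemma circuit_closed_trail:
  assumes "multigraph F" "\<gamma> \<in> circuits F" "ws \<in> \<gamma>"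
  shows "closed_trail F ws"
proof -
  obtain ws0 where ws0: "closed_trail F ws0"
    and cs: "\<And>ws. ws \<in> \<gamma> \<Longrightarrow>
      (\<exists>n. ws = rotate n ws0) \<or> (\<exists>n. ws = rotate n (rev (map (opp F) ws0)))"
    using circuit_element[OF assms(1,2)] by blast
  show ?thesis
    using cs[OF assms(3)] closed_trail_rotate[OF ws0]
      closed_trail_rotate[OF closed_trail_reverse[OF assms(1) ws0]] by auto
qed

lemma circuit_rotate:
  assumes "multigraph F" "\<gamma> \<in> circuits F" "ws \<in> \<gamma>"
  shows "rotate m ws \<in> \<gamma>"
proof -
  obtain ws0 where
    cs: "\<And>ws. ws \<in> \<gamma> \<Longrightarrow>
      (\<exists>n. ws = rotate n ws0) \<or> (\<exists>n. ws = rotate n (rev (map (opp F) ws0)))"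
    and mem: "\<And>n. rotate n ws0 \<in> \<gamma>" "\<And>n. rotate n (rev (map (opp F) ws0)) \<in> \<gamma>"
    using circuit_element[OF assms(1,2)] by blast
  show ?thesis
    using cs[OF assms(3)] mem by (auto simp: rotate_rotate)
qed

lemma circuit_nonempty:
  assumes "multigraph F" "\<gamma> \<in> circuits F"
  obtains ws where "ws \<in> \<gamma>"
  using circuit_element[OF assms] by blast

lemma circuit_set_cases:
  assumes "multigraph F" "\<gamma> \<in> circuits F" "ws \<in> \<gamma>" "ws' \<in> \<gamma>"
  shows "set ws' = set ws \<or> set ws' = opp F ` set ws"
proof -
  obtain ws0 where ws0: "closed_trail F ws0"
    and cs: "\<And>ws. ws \<in> \<gamma> \<Longrightarrow>
      (\<exists>n. ws = rotate n ws0) \<or> (\<exists>n. ws = rotate n (rev (map (opp F) ws0)))"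
    using circuit_element[OF assms(1,2)] by blast
  have *: "set us = set ws0 \<or> set us = opp F ` set ws0" if "us \<in> \<gamma>" for us
    using cs[OF that] by auto
  have "set ws0 \<subseteq> halves F" using ws0 unfolding closed_trail_def by auto
  then have "opp F ` opp F ` set ws0 = set ws0"
    by (rule opp_image_opp[OF assms(1)])
  then show ?thesis using *[OF assms(3)] *[OF assms(4)] by auto
qed

lemma circuit_halves_eq:
  assumes "multigraph F" "\<gamma> \<in> circuits F" "ws \<in> \<gamma>"
  shows "circuit_halves \<gamma> = set ws \<union> opp F ` set ws"
proof
  show "circuit_halves \<gamma> \<subseteq> set ws \<union> opp F ` set ws"
    using circuit_set_cases[OF assms] unfolding circuit_halves_def by blast
  obtain ws0 where ws0: "closed_trail F ws0" "ws0 \<in> \<gamma>"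
    "\<And>n. rotate n (rev (map (opp F) ws0)) \<in> \<gamma>"
    using circuit_element[OF assms(1,2)] by blast
  have "set ws0 \<union> opp F ` set ws0 \<subseteq> circuit_halves \<gamma>"
    using ws0(2) ws0(3)[of 0] unfolding circuit_halves_def by force
  moreover have "set ws \<union> opp F ` set ws = set ws0 \<union> opp F ` set ws0"
  proof -
    have "set ws0 \<subseteq> halves F" using ws0 unfolding closed_trail_def by auto
    then have "opp F ` opp F ` set ws0 = set ws0"
      by (rule opp_image_opp[OF assms(1)])
    then show ?thesis using circuit_set_cases[OF assms(1,2) ws0(2) assms(3)] by auto
  qed
  ultimately show "set ws \<union> opp F ` set ws \<subseteq> circuit_halves \<gamma>" by simp
qed

lemma circuit_halves_subset:
  assumes "multigraph F" "\<gamma> \<in> circuits F"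
  shows "circuit_halves \<gamma> \<subseteq> halves F"
proof -
  obtain ws where ws: "ws \<in> \<gamma>" using circuit_nonempty[OF assms] .
  have "set ws \<subseteq> halves F"
    using circuit_closed_trail[OF assms ws] unfolding closed_trail_def by auto
  then show ?thesis
    using circuit_halves_eq[OF assms ws] by (auto simp: multigraph_opp[OF assms(1)])
qed

lemma circuit_halves_opp:
  assumes "multigraph F" "\<gamma> \<in> circuits F" "h \<in> circuit_halves \<gamma>"
  shows "opp F h \<in> circuit_halves \<gamma>"
proof -
  obtain ws where ws: "ws \<in> \<gamma>" using circuit_nonempty[OF assms(1,2)] .
  have "set ws \<subseteq> halves F"
    using circuit_closed_trail[OF assms(1,2) ws] unfolding closed_trail_def by auto
  then show ?thesis
    using assms(3) circuit_halves_eq[OF assms(1,2) ws] by (auto simp: multigraph_opp[OF assms(1)])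
qed

lemma circuit_halves_nonempty:
  assumes "multigraph F" "\<gamma> \<in> circuits F"
  obtains h where "h \<in> circuit_halves \<gamma>"
proof -
  obtain ws where ws: "ws \<in> \<gamma>" using circuit_nonempty[OF assms] .
  then have "hd ws \<in> circuit_halves \<gamma>"
    using circuit_closed_trail[OF assms ws] circuit_halves_eq[OF assms ws]
    unfolding closed_trail_def by auto
  then show ?thesis using that by blast
qed

lemma circuit_alternating:
  assumes "multigraph F" "\<gamma> \<in> circuits F" "ws \<in> \<gamma>" "ws' \<in> \<gamma>"
  shows "alternating (map (vert F) ws) v w \<longleftrightarrow> alternating (map (vert F) ws') v w"
proof -
  obtain ws0 where ws0: "closed_trail F ws0"
    and cs: "\<And>ws. ws \<in> \<gamma> \<Longrightarrow>
      (\<exists>n. ws = rotate n ws0) \<or> (\<exists>n. ws = rotate n (rev (map (opp F) ws0)))"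
    using circuit_element[OF assms(1,2)] by blast
  have rev: "map (vert F) (rev (map (opp F) ws0)) = rev (rotate 1 (map (vert F) ws0))"
    using closed_trail_heads[OF ws0] by (simp add: comp_def flip: rev_map)
  have "alternating (map (vert F) us) v w \<longleftrightarrow> alternating (map (vert F) ws0) v w"
    if "us \<in> \<gamma>" for us
    using cs[OF that] by (auto simp: alternating_rotate alternating_rev rev simp del: rotate_Suc One_nat_def
        simp flip: rotate_map)
  then show ?thesis using assms by blast
qed

lemma circuit_pass_subset:
  assumes "multigraph F" "\<gamma> \<in> circuits F" "p \<in> circuit_passes F \<gamma>"
  shows "p \<subseteq> circuit_halves \<gamma>"
proof -
  obtain ws i where ws: "ws \<in> \<gamma>" "i < length ws" "p = {opp F (ws ! i), ws ! (Suc i mod length ws)}"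
    using assms(3) unfolding circuit_passes_def by auto
  then have "Suc i mod length ws < length ws" by (intro mod_less_divisor) auto
  then show ?thesis using ws circuit_halves_eq[OF assms(1,2) ws(1)] by auto
qed


section \<open>Circuit partitions\<close>

lemma circuit_partition_circuits:
  "circuit_partition F P \<Longrightarrow> \<gamma> \<in> P \<Longrightarrow> \<gamma> \<in> circuits F"
  unfolding circuit_partition_def by auto

lemma circuit_partition_unique:
  assumes "multigraph F" "circuit_partition F P" "\<gamma> \<in> P" "\<delta> \<in> P"
    "h \<in> circuit_halves \<gamma>" "h \<in> circuit_halves \<delta>"
  shows "\<gamma> = \<delta>"
proof (rule ccontr)
  assume "\<gamma> \<noteq> \<delta>"
  then have "circuit_edges F \<gamma> \<inter> circuit_edges F \<delta> = {}"
    using assms(2-4) unfolding circuit_partition_def disjoint_family_on_def by auto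
  then show False
    using assms(5,6) unfolding circuit_edges_def by auto
qed

lemma circuit_partition_covers:
  assumes "multigraph F" "circuit_partition F P" "h \<in> halves F"
  obtains \<gamma> where "\<gamma> \<in> P" "h \<in> circuit_halves \<gamma>"
proof -
  have "full_edge F h \<in> (\<Union>\<gamma>\<in>P. circuit_edges F \<gamma>)"
    using assms(2,3) unfolding circuit_partition_def edges_def by auto
  then obtain \<gamma> h' where \<gamma>: "\<gamma> \<in> P" "h' \<in> circuit_halves \<gamma>" "full_edge F h' = full_edge F h"
    unfolding circuit_edges_def by auto
  have circ: "\<gamma> \<in> circuits F" by (rule circuit_partition_circuits[OF assms(2) \<gamma>(1)])
  have "h' \<in> halves F" using circuit_halves_subset[OF assms(1) circ] \<gamma>(2) by auto
  then have "h = h' \<or> h = opp F h'"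
    using full_edge_eq_iff[OF assms(1) _ assms(3)] \<gamma>(3) by auto
  then have "h \<in> circuit_halves \<gamma>"
    using \<gamma>(2) circuit_halves_opp[OF assms(1) circ \<gamma>(2)] by auto
  then show ?thesis using that \<gamma>(1) by blast
qed

text \<open>The member of a circuit partition that contains a given half-edge.\<close>

definition circuit_through :: "'h list set set \<Rightarrow> 'h \<Rightarrow> 'h list set" where
  "circuit_through P h = (THE \<gamma>. \<gamma> \<in> P \<and> h \<in> circuit_halves \<gamma>)"

lemma circuit_through_eq:
  assumes "multigraph F" "circuit_partition F P" "\<gamma> \<in> P" "h \<in> circuit_halves \<gamma>"
  shows "circuit_through P h = \<gamma>"
  unfolding circuit_through_def
proof (rule the_equality)
  show "\<gamma> \<in> P \<and> h \<in> circuit_halves \<gamma>" using assms by blast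
  show "\<delta> = \<gamma>" if "\<delta> \<in> P \<and> h \<in> circuit_halves \<delta>" for \<delta>
    using circuit_partition_unique[OF assms(1,2) assms(3)] assms(4) that by metis
qed

lemma circuit_through:
  assumes "multigraph F" "circuit_partition F P" "h \<in> halves F"
  shows "circuit_through P h \<in> P" "h \<in> circuit_halves (circuit_through P h)"
proof -
  obtain \<gamma> where "\<gamma> \<in> P" "h \<in> circuit_halves \<gamma>"
    using circuit_partition_covers[OF assms] .
  then show "circuit_through P h \<in> P" "h \<in> circuit_halves (circuit_through P h)"
    using circuit_through_eq[OF assms(1,2)] by auto
qed

lemma circuit_partition_finite:
  assumes "multigraph F" "circuit_partition F P"
  shows "finite P"
proof (rule finite_subset)
  show "P \<subseteq> circuit_through P ` halves F"
  proof
    fix \<gamma> assume \<gamma>: "\<gamma> \<in> P"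
    note circ = circuit_partition_circuits[OF assms(2) \<gamma>]
    obtain h where h: "h \<in> circuit_halves \<gamma>" using circuit_halves_nonempty[OF assms(1) circ] .
    then show "\<gamma> \<in> circuit_through P ` halves F"
      using circuit_through_eq[OF assms \<gamma> h] circuit_halves_subset[OF assms(1) circ] by blast
  qed
  show "finite (circuit_through P ` halves F)"
    using assms(1) unfolding multigraph_def by auto
qed

lemma transition_at_mem:
  "circuit_partition F P \<Longrightarrow> transition_at F P v \<in> transitions F v"
  unfolding circuit_partition_def by auto

lemma transition_unique:
  assumes "T \<in> transitions F v" "p \<in> T" "q \<in> T" "h \<in> p" "h \<in> q"
  shows "p = q"
  using assms unfolding transitions_def partition_on_def disjoint_def by blast

lemma transition_covers:
  assumes "T \<in> transitions F v" "h \<in> halves_at F v"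
  obtains p where "p \<in> T" "h \<in> p"
  using assms unfolding transitions_def partition_on_def by blast

lemma transition_subset:
  assumes "T \<in> transitions F v" "p \<in> T"
  shows "p \<subseteq> halves_at F v"
  using assms unfolding transitions_def partition_on_def by blast

lemma transition_in_circuit:
  assumes "multigraph F" "circuit_partition F P" "p \<in> transition_at F P v"
  obtains \<gamma> where "\<gamma> \<in> P" "p \<subseteq> circuit_halves \<gamma>"
proof -
  obtain \<gamma> where \<gamma>: "\<gamma> \<in> P" "p \<in> circuit_passes F \<gamma>"
    using assms(3) unfolding transition_at_def by auto
  then show ?thesis
    using that circuit_pass_subset[OF assms(1) circuit_partition_circuits[OF assms(2)]] by blast
qed

lemma pass_in_transition:
  assumes "multigraph F" "circuit_partition F P" "\<gamma> \<in> P" "ws \<in> \<gamma>" "i < length ws"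
  shows "{opp F (ws ! i), ws ! (Suc i mod length ws)} \<in>
    transition_at F P (vert F (ws ! (Suc i mod length ws)))"
proof -
  have trail: "closed_trail F ws"
    by (rule circuit_closed_trail[OF assms(1) circuit_partition_circuits[OF assms(2,3)] assms(4)])
  have lt: "Suc i mod length ws < length ws"
    using assms(5) by (intro mod_less_divisor) auto
  have "{opp F (ws ! i), ws ! (Suc i mod length ws)} \<in> circuit_passes F \<gamma>"
    using assms(4,5) unfolding circuit_passes_def by blast
  then show ?thesis
    using assms(3) closed_trail_nth_in[OF trail assms(5)] closed_trail_nth_in[OF trail lt]
      closed_trail_step[OF trail assms(5)] multigraph_opp[OF assms(1)]
    unfolding transition_at_def halves_at_def by auto
qed

lemma transition_cases:
  assumes "T \<in> transitions F v" "halves_at F v = {a, b, c, d}" "distinct [a, b, c, d]"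
  shows "T = {{a, b}, {c, d}} \<or> T = {{a, c}, {b, d}} \<or> T = {{a, d}, {b, c}}"
proof -
  have two: "\<exists>y. y \<noteq> x \<and> p = {x, y}" if "p \<in> T" "x \<in> p" for p x
  proof -
    have "card p = 2" using assms(1) that(1) unfolding transitions_def by auto
    then show ?thesis using that(2) by (auto simp: card_2_iff)
  qed
  have part: "{a, b, c, d} = {x, y, z, w} \<Longrightarrow> distinct [x, y, z, w] \<Longrightarrow> {x, y} \<in> T \<Longrightarrow>
      T = {{x, y}, {z, w}}" for x y z w
  proof -
    assume eq: "{a, b, c, d} = {x, y, z, w}" and dist: "distinct [x, y, z, w]" and xy: "{x, y} \<in> T"
    have z: "z \<in> halves_at F v" using eq assms(2) by auto
    obtain q where q: "q \<in> T" "z \<in> q" using transition_covers[OF assms(1) z] .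
    obtain u where u: "u \<noteq> z" "q = {z, u}" using two[OF q] by auto
    have "u \<in> {x, y, z, w}" using transition_subset[OF assms(1) q(1)] u eq assms(2) by auto
    moreover have "u \<notin> {x, y}"
      using transition_unique[OF assms(1) q(1) xy, of u] u dist by auto
    ultimately have zw: "{z, w} \<in> T" using u q by auto
    have "p \<in> {{x, y}, {z, w}}" if p: "p \<in> T" for p
    proof -
      have "p \<noteq> {}" using assms(1) p unfolding transitions_def by auto
      then obtain t where t: "t \<in> p" by auto
      then have "t \<in> {x, y} \<or> t \<in> {z, w}"
        using transition_subset[OF assms(1) p] eq assms(2) by auto
      then show ?thesis
        using transition_unique[OF assms(1) p xy t] transition_unique[OF assms(1) p zw t] by auto
    qed
    then show ?thesis using xy zw by auto
  qed
  have a: "a \<in> halves_at F v" using assms(2) by auto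
  obtain p where p: "p \<in> T" "a \<in> p" using transition_covers[OF assms(1) a] .
  obtain y where y: "y \<noteq> a" "p = {a, y}" using two[OF p] by auto
  have "y \<in> {b, c, d}" using transition_subset[OF assms(1) p(1)] y assms(2) by auto
  then consider "{a, b} \<in> T" | "{a, c} \<in> T" | "{a, d} \<in> T" using p y by auto
  then show ?thesis
  proof cases
    case 1
    have "T = {{a, b}, {c, d}}" by (rule part) (use 1 assms(3) in auto)
    then show ?thesis by blast
  next
    case 2
    have "T = {{a, c}, {b, d}}" by (rule part) (use 2 assms(3) in auto)
    then show ?thesis by blast
  next
    case 3
    have "T = {{a, d}, {b, c}}" by (rule part) (use 3 assms(3) in auto)
    then show ?thesis by blast
  qed
qed

lemma transition_two_pairs:
  assumes "four_regular F" "T \<in> transitions F v"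
  obtains p q where "T = {p, q}" "p \<inter> q = {}" "p \<union> q = halves_at F v" "card p = 2" "card q = 2"
proof -
  have "card (halves_at F v) = 4" using assms(1) unfolding four_regular_def by auto
  moreover have "card (halves_at F v) = sum card T"
  proof -
    have "\<forall>p\<in>T. finite p" using assms(2) unfolding transitions_def by (auto intro: card_ge_0_finite)
    then show ?thesis
      using assms(2) card_Union_disjoint[of T]
      unfolding transitions_def partition_on_def disjoint_def pairwise_def disjnt_def by auto
  qed
  moreover have "sum card T = (\<Sum>p\<in>T. 2)"
    using assms(2) unfolding transitions_def by (intro sum.cong) auto
  ultimately have "card T = 2" by simp
  then obtain p q where pq: "T = {p, q}" "p \<noteq> q" by (auto simp: card_2_iff)
  show ?thesis
    by (rule that[of p q]) (use assms(2) pq in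
      \<open>auto simp: transitions_def partition_on_def disjoint_def\<close>)
qed


section \<open>Edge labellings with prescribed jumps\<close>

text \<open>
  A labelling of the edges by \<open>GF(2)\<close>, whose value changes by \<open>x $ v\<close> at every pass of the circuits of
  \<open>P\<close> through \<open>v\<close>. It is given on half-edges, and its values outside \<open>halves F\<close> are irrelevant. For
  \<open>x = 0\<close> these are the labellings that are constant on every circuit of \<open>P\<close>.
\<close>

definition jumps ::
    "('v::finite, 'h) multigraph \<Rightarrow> 'h list set set \<Rightarrow> bit ^ 'v \<Rightarrow> ('h \<Rightarrow> bit) \<Rightarrow> bool" where
  "jumps F P x f \<longleftrightarrow> (\<forall>h\<in>halves F. f (opp F h) = f h) \<and>
     (\<forall>v. \<forall>p\<in>transition_at F P v. \<forall>h\<in>p. \<forall>h'\<in>p. h \<noteq> h' \<longrightarrow> f h' = f h + x $ v)"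

lemma jumpsD:
  assumes "jumps F P x f" "p \<in> transition_at F P v" "h \<in> p" "h' \<in> p" "h \<noteq> h'"
  shows "f h' = f h + x $ v"
proof -
  have "\<forall>v. \<forall>p\<in>transition_at F P v. \<forall>h\<in>p. \<forall>h'\<in>p. h \<noteq> h' \<longrightarrow> f h' = f h + x $ v"
    using assms(1) unfolding jumps_def by (rule conjunct2)
  from this[rule_format, OF assms(2-5)] show ?thesis .
qed

lemma jumps_opp:
  "jumps F P x f \<Longrightarrow> h \<in> halves F \<Longrightarrow> f (opp F h) = f h"
  unfolding jumps_def by simp

lemma jumpsI:
  assumes "\<And>h. h \<in> halves F \<Longrightarrow> f (opp F h) = f h"
    and "\<And>v p h h'. p \<in> transition_at F P v \<Longrightarrow> h \<in> p \<Longrightarrow> h' \<in> p \<Longrightarrow> h \<noteq> h' \<Longrightarrow>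
      f h' = f h + x $ v"
  shows "jumps F P x f"
  unfolding jumps_def by (intro conjI ballI allI impI assms)

lemma jumps_step:
  assumes "multigraph F" "circuit_partition F P" "jumps F P x f" "\<gamma> \<in> P" "ws \<in> \<gamma>" "i < length ws"
  shows "f (ws ! (Suc i mod length ws)) = f (ws ! i) + x $ (vert F (ws ! (Suc i mod length ws)))"
proof -
  have trail: "closed_trail F ws"
    by (rule circuit_closed_trail[OF assms(1) circuit_partition_circuits[OF assms(2,4)] assms(5)])
  have lt: "Suc i mod length ws < length ws"
    using assms(6) by (intro mod_less_divisor) auto
  have "opp F (ws ! i) \<noteq> ws ! (Suc i mod length ws)"
    using closed_trail_opp_notin[OF assms(1) trail, of "ws ! i"] assms(6) lt by force
  then have "f (ws ! (Suc i mod length ws)) =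
      f (opp F (ws ! i)) + x $ (vert F (ws ! (Suc i mod length ws)))"
    by (intro jumpsD[OF assms(3) pass_in_transition[OF assms(1,2,4,5,6)]]) auto
  then show ?thesis
    using jumps_opp[OF assms(3) closed_trail_nth_in[OF trail assms(6)]] by simp
qed

lemma jumps_along:
  assumes "multigraph F" "circuit_partition F P" "jumps F P x f" "\<gamma> \<in> P" "ws \<in> \<gamma>" "i < length ws"
  shows "f (ws ! i) = f (ws ! 0) + (\<Sum>m\<in>{0<..i}. x $ (vert F (ws ! m)))"
  using assms(6)
proof (induction i)
  case (Suc i)
  have "{0<..Suc i} = insert (Suc i) {0<..i}" by auto
  then show ?case
    using Suc jumps_step[OF assms(1-5), of i] by (simp add: ac_simps)
qed simp

lemma jumps_0_constant:
  assumes "multigraph F" "circuit_partition F P" "jumps F P 0 f" "\<gamma> \<in> P"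
    "h \<in> circuit_halves \<gamma>" "h' \<in> circuit_halves \<gamma>"
  shows "f h = f h'"
proof -
  note circ = circuit_partition_circuits[OF assms(2,4)]
  obtain ws where ws: "ws \<in> \<gamma>" using circuit_nonempty[OF assms(1) circ] .
  have sub: "set ws \<subseteq> halves F"
    using circuit_closed_trail[OF assms(1) circ ws] unfolding closed_trail_def by auto
  have on_ws: "f g = f (ws ! 0)" if "g \<in> set ws" for g
    using that jumps_along[OF assms(1-4) ws] by (auto simp: in_set_conv_nth)
  have "f g = f (ws ! 0)" if "g \<in> circuit_halves \<gamma>" for g
    using that on_ws sub jumps_opp[OF assms(3)] circuit_halves_eq[OF assms(1) circ ws] by auto
  then show ?thesis using assms(5,6) by metis
qed

text \<open>
  Conversely, prescribing a value \<open>c \<gamma>\<close> for every circuit \<open>\<gamma>\<close> of \<open>P\<close> gives a labelling without jumps.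
\<close>

lemma jumps_0I:
  assumes "multigraph F" "circuit_partition F P"
  shows "jumps F P 0 (\<lambda>h. c (circuit_through P h))"
proof -
  have "circuit_through P (opp F h) = circuit_through P h" if h: "h \<in> halves F" for h
  proof (rule circuit_through_eq[OF assms])
    note * = circuit_through[OF assms h]
    show "circuit_through P h \<in> P" by (rule *)
    show "opp F h \<in> circuit_halves (circuit_through P h)"
      by (rule circuit_halves_opp[OF assms(1) circuit_partition_circuits[OF assms(2) *(1)] *(2)])
  qed
  moreover have "circuit_through P h = circuit_through P h'"
    if p: "p \<in> transition_at F P v" and h: "h \<in> p" "h' \<in> p" for p h h' v
  proof -
    obtain \<gamma> where "\<gamma> \<in> P" "p \<subseteq> circuit_halves \<gamma>" using transition_in_circuit[OF assms p] .
    then show ?thesis using circuit_through_eq[OF assms] h by (metis subsetD)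
  qed
  ultimately show ?thesis
    by (intro jumpsI) (metis, metis add.right_neutral zero_index)
qed

lemma in_component: "v \<in> (adjacency F)\<^sup>* `` {v}"
  by simp

lemma component_mem: "(adjacency F)\<^sup>* `` {v} \<in> graph_components F"
  unfolding graph_components_def quotient_def by auto

lemma component_opp:
  assumes "multigraph F" "K \<in> graph_components F" "h \<in> halves F"
  shows "vert F (opp F h) \<in> K \<longleftrightarrow> vert F h \<in> K"
proof -
  have step: "(vert F g, vert F (opp F g)) \<in> adjacency F" if "g \<in> halves F" for g
    using that unfolding adjacency_def by auto
  obtain u where K: "K = (adjacency F)\<^sup>* `` {u}"
    using assms(2) unfolding graph_components_def quotient_def by auto
  show ?thesis
    using step[OF assms(3)] step[of "opp F h"] multigraph_opp[OF assms(1,3)] unfolding K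
    by (auto intro: rtrancl_into_rtrancl)
qed

text \<open>
  The indicator of a component has no jumps; hence a circuit does not leave its component.
\<close>

lemma jumps_0_component:
  assumes "multigraph F" "circuit_partition F P" "K \<in> graph_components F"
  shows "jumps F P 0 (\<lambda>h. of_bool (vert F h \<in> K))"
proof (rule jumpsI)
  fix h assume "h \<in> halves F"
  then show "of_bool (vert F (opp F h) \<in> K) = (of_bool (vert F h \<in> K) :: bit)"
    using component_opp[OF assms(1,3)] by simp
next
  fix v p h h' assume "p \<in> transition_at F P v" "h \<in> p" "h' \<in> p"
  then have "vert F h = v" "vert F h' = v"
    using transition_subset[OF transition_at_mem[OF assms(2)]] unfolding halves_at_def by blast+
  then show "of_bool (vert F h' \<in> K) = of_bool (vert F h \<in> K) + (0 :: bit ^ _) $ v" by simp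
qed

lemma circuit_in_component:
  assumes "multigraph F" "circuit_partition F P" "K \<in> graph_components F" "\<gamma> \<in> P"
    "h \<in> circuit_halves \<gamma>"
  shows "\<gamma> \<in> incident_circuits F P K \<longleftrightarrow> vert F h \<in> K"
proof -
  have "vert F h \<in> K" if h': "h' \<in> circuit_halves \<gamma>" "vert F h' \<in> K" for h'
    using jumps_0_constant[OF assms(1,2) jumps_0_component[OF assms(1-3)] assms(4,5) h'(1)] h'(2)
    by (simp split: if_splits)
  then show ?thesis
    using assms(4,5) unfolding incident_circuits_def circuit_verts_def by blast
qed


text \<open>
  A circuit of \<open>P\<close> is singly incident at \<open>v\<close> if and only if it owns exactly one of the two pairs of the
  transition of \<open>P\<close> there. If one circuit owns both, the two terms on the right cancel.
\<close>

lemma sum_singly_incident: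
  fixes c :: "'h list set \<Rightarrow> bit"
  assumes "four_regular F" "circuit_partition F P" "transition_at F P v = {p, q}" "p \<noteq> q"
    "ha \<in> p" "hb \<in> q"
  shows "(\<Sum>\<gamma>\<in>P. c \<gamma> * of_bool (card (circuit_halves \<gamma> \<inter> halves_at F v) = 2)) =
     c (circuit_through P ha) + c (circuit_through P hb)"
proof -
  have mg: "multigraph F" using assms(1) unfolding four_regular_def by auto
  note T = transition_at_mem[OF assms(2), of v]
  obtain p' q' where "transition_at F P v = {p', q'}" "p' \<inter> q' = {}" "p' \<union> q' = halves_at F v"
    "card p' = 2" "card q' = 2"
    using transition_two_pairs[OF assms(1) T] .
  then have pq: "p \<inter> q = {}" "p \<union> q = halves_at F v" "card p = 2" "card q = 2"
    using assms(3,4) by (auto simp: doubleton_eq_iff)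
  let ?A = "circuit_through P ha" and ?B = "circuit_through P hb"
  have pair: "circuit_through P h \<in> P \<and>
      (\<gamma> \<in> P \<longrightarrow> circuit_halves \<gamma> \<inter> r = (if \<gamma> = circuit_through P h then r else {}))"
    if r: "r \<in> transition_at F P v" and h: "h \<in> r" for r h \<gamma>
  proof -
    obtain \<delta> where \<delta>: "\<delta> \<in> P" "r \<subseteq> circuit_halves \<delta>"
      using transition_in_circuit[OF mg assms(2) r] .
    have \<delta>_eq: "circuit_through P h = \<delta>"
      using circuit_through_eq[OF mg assms(2) \<delta>(1)] \<delta>(2) h by auto
    have "circuit_halves \<gamma> \<inter> r = {}" if "\<gamma> \<in> P" "\<gamma> \<noteq> \<delta>"
      using circuit_partition_unique[OF mg assms(2) that(1) \<delta>(1)] \<delta>(2) that(2) by blast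
    then show ?thesis using \<delta> \<delta>_eq by auto
  qed
  have A: "?A \<in> P" "\<And>\<gamma>. \<gamma> \<in> P \<Longrightarrow> circuit_halves \<gamma> \<inter> p = (if \<gamma> = ?A then p else {})"
    using pair[of p ha] assms(3,5) by auto
  have B: "?B \<in> P" "\<And>\<gamma>. \<gamma> \<in> P \<Longrightarrow> circuit_halves \<gamma> \<inter> q = (if \<gamma> = ?B then q else {})"
    using pair[of q hb] assms(3,6) by auto
  have fin: "finite p" "finite q" using pq by (auto intro: card_ge_0_finite)
  have "c \<gamma> * of_bool (card (circuit_halves \<gamma> \<inter> halves_at F v) = 2) =
      (if \<gamma> = ?A then c \<gamma> else 0) + (if \<gamma> = ?B then c \<gamma> else 0)" if \<gamma>: "\<gamma> \<in> P" for \<gamma>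
  proof -
    have "circuit_halves \<gamma> \<inter> halves_at F v = (circuit_halves \<gamma> \<inter> p) \<union> (circuit_halves \<gamma> \<inter> q)"
      using pq(2) by auto
    then have "card (circuit_halves \<gamma> \<inter> halves_at F v) =
        (if \<gamma> = ?A then 2 else 0) + (if \<gamma> = ?B then 2 else 0)"
      using A(2)[OF \<gamma>] B(2)[OF \<gamma>] pq fin by (simp add: card_Un_disjoint)
    then show ?thesis by (auto simp: bit_add_self)
  qed
  then have "(\<Sum>\<gamma>\<in>P. c \<gamma> * of_bool (card (circuit_halves \<gamma> \<inter> halves_at F v) = 2)) =
      (\<Sum>\<gamma>\<in>P. (if \<gamma> = ?A then c \<gamma> else 0) + (if \<gamma> = ?B then c \<gamma> else 0))"
    by (rule sum.cong[OF refl])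
  also have "\<dots> = c ?A + c ?B"
    using A(1) B(1) circuit_partition_finite[OF mg assms(2)] by (simp add: sum.distrib)
  finally show ?thesis .
qed


section \<open>Euler circuits\<close>

lemma four_regular_multigraph: "four_regular F \<Longrightarrow> multigraph F"
  unfolding four_regular_def by simp

lemma euler_partition: "euler_system F C \<Longrightarrow> circuit_partition F C"
  unfolding euler_system_def by simp

lemma euler_unique_circuit:
  assumes "multigraph F" "euler_system F C" "K \<in> graph_components F" "\<gamma> \<in> C" "\<delta> \<in> C"
    "h \<in> circuit_halves \<gamma>" "h' \<in> circuit_halves \<delta>" "vert F h \<in> K" "vert F h' \<in> K"
  shows "\<gamma> = \<delta>"
proof -
  have "\<gamma> \<in> incident_circuits F C K" "\<delta> \<in> incident_circuits F C K"
    using assms(4-9) unfolding incident_circuits_def circuit_verts_def by auto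
  then show ?thesis using assms(2,3) unfolding euler_system_def by blast
qed

lemma euler_unique_circuit_at:
  assumes "multigraph F" "euler_system F C" "\<gamma> \<in> C" "\<delta> \<in> C"
    "v \<in> circuit_verts F \<gamma>" "v \<in> circuit_verts F \<delta>"
  shows "\<gamma> = \<delta>"
proof -
  obtain h h' where "h \<in> circuit_halves \<gamma>" "vert F h = v" "h' \<in> circuit_halves \<delta>" "vert F h' = v"
    using assms(5,6) unfolding circuit_verts_def by auto
  then show ?thesis
    using euler_unique_circuit[OF assms(1,2) component_mem[of F v] assms(3,4), of h h']
      in_component[of v F] by auto
qed

lemma euler_halves_at:
  assumes "multigraph F" "euler_system F C" "\<gamma> \<in> C" "v \<in> circuit_verts F \<gamma>"
  shows "halves_at F v \<subseteq> circuit_halves \<gamma>"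
proof
  fix h assume h: "h \<in> halves_at F v"
  then have hh: "h \<in> halves F" "vert F h = v" unfolding halves_at_def by auto
  note th = circuit_through[OF assms(1) euler_partition[OF assms(2)] hh(1)]
  have "v \<in> circuit_verts F (circuit_through C h)"
    using th(2) hh(2) unfolding circuit_verts_def by auto
  then show "h \<in> circuit_halves \<gamma>"
    using euler_unique_circuit_at[OF assms(1-3) th(1) assms(4)] th(2) by simp
qed

lemma circuit_halves_at:
  assumes "multigraph F" "\<gamma> \<in> circuits F" "ws \<in> \<gamma>"
  shows "circuit_halves \<gamma> \<inter> halves_at F v = in_halves F ws v \<union> out_halves F ws v"
  using circuit_halves_eq[OF assms] circuit_halves_subset[OF assms(1,2)]
  unfolding halves_at_def in_halves_def out_halves_def by blast

lemma euler_visits: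
  assumes "four_regular F" "euler_system F C" "\<gamma> \<in> C" "ws \<in> \<gamma>"
  shows "card {i. i < length ws \<and> vert F (ws ! i) = v} = (if v \<in> circuit_verts F \<gamma> then 2 else 0)"
proof -
  note mg = four_regular_multigraph[OF assms(1)]
  note circ = circuit_partition_circuits[OF euler_partition[OF assms(2)] assms(3)]
  note halves = circuit_halves_eq[OF mg circ assms(4)]
  note trail = circuit_closed_trail[OF mg circ assms(4)]
  have sub: "set ws \<subseteq> halves F" and "distinct (map (full_edge F) ws)"
    using trail unfolding closed_trail_def by auto
  then have dist: "distinct ws" by (simp add: distinct_map)
  have "inj_on (opp F) (set ws)"
    using sub by (intro inj_on_inverseI[where g = "opp F"]) (auto simp: multigraph_opp(3)[OF mg])
  then have dist_opp: "distinct (map (opp F) ws)" using dist by (simp add: distinct_map)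
  show ?thesis
  proof (cases "v \<in> circuit_verts F \<gamma>")
    case False
    then have "{i. i < length ws \<and> vert F (ws ! i) = v} = {}"
      using halves unfolding circuit_verts_def by auto
    then show ?thesis using False by simp
  next
    case True
    let ?n = "card {i. i < length ws \<and> vert F (ws ! i) = v}"
    have n: "?n = length (filter (\<lambda>u. u = v) (map (vert F) ws))"
      by (simp add: length_filter_conv_card cong: conj_cong)
    have "out_halves F ws v = set (filter (\<lambda>h. vert F h = v) ws)"
      unfolding out_halves_def by auto
    moreover have "card \<dots> = length (filter (\<lambda>h. vert F h = v) ws)"
      using dist by (intro distinct_card distinct_filter)
    ultimately have out: "card (out_halves F ws v) = ?n" "finite (out_halves F ws v)"
      unfolding n by (simp_all add: filter_map comp_def)
    have "in_halves F ws v = set (filter (\<lambda>h. vert F h = v) (map (opp F) ws))"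
      unfolding in_halves_def by auto
    moreover have "card \<dots> = length (filter (\<lambda>h. vert F h = v) (map (opp F) ws))"
      using dist_opp by (intro distinct_card distinct_filter)
    moreover have "length (filter (\<lambda>h. vert F h = v) (map (opp F) ws)) =
        length (filter (\<lambda>u. u = v) (map (\<lambda>h. vert F (opp F h)) ws))"
      by (simp add: filter_map comp_def)
    moreover have "length (filter (\<lambda>u. u = v) (rotate1 us)) = length (filter (\<lambda>u. u = v) us)" for us
      by (cases us) auto
    ultimately have in_card: "card (in_halves F ws v) = ?n" "finite (in_halves F ws v)"
      unfolding closed_trail_heads[OF trail] n by auto
    have "in_halves F ws v \<inter> out_halves F ws v = {}"
      using closed_trail_opp_notin[OF mg trail] unfolding in_halves_def out_halves_def by auto
    moreover have "halves_at F v = in_halves F ws v \<union> out_halves F ws v"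
      using euler_halves_at[OF mg assms(2,3) True] circuit_halves_at[OF mg circ assms(4)] by auto
    ultimately have "card (halves_at F v) = ?n + ?n"
      using out in_card by (simp add: card_Un_disjoint)
    then show ?thesis using True assms(1) unfolding four_regular_def by simp
  qed
qed

text \<open>
  An Euler circuit of \<open>C\<close>, based at its first visit to \<open>v\<close>; the second visit is at position \<open>k\<close>.
\<close>

definition tour_from ::
    "('v, 'h) multigraph \<Rightarrow> 'h list set set \<Rightarrow> 'v \<Rightarrow> 'h list \<Rightarrow> nat \<Rightarrow> bool" where
  "tour_from F C v ws k \<longleftrightarrow> (\<exists>\<gamma>\<in>C. ws \<in> \<gamma>) \<and> 0 < k \<and> k < length ws \<and>
     (\<forall>i<length ws. vert F (ws ! i) = v \<longleftrightarrow> i = 0 \<or> i = k)"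

lemma tour_exists:
  assumes "four_regular F" "euler_system F C"
  obtains ws k where "tour_from F C v ws k"
proof -
  note mg = four_regular_multigraph[OF assms(1)]
  have "card (halves_at F v) = 4" using assms(1) unfolding four_regular_def by blast
  then have "halves_at F v \<noteq> {}" by auto
  then obtain h where h: "h \<in> halves F" "vert F h = v" unfolding halves_at_def by auto
  define \<gamma> where "\<gamma> = circuit_through C h"
  have \<gamma>: "\<gamma> \<in> C" "h \<in> circuit_halves \<gamma>"
    using circuit_through[OF mg euler_partition[OF assms(2)] h(1)] unfolding \<gamma>_def by auto
  note circ = circuit_partition_circuits[OF euler_partition[OF assms(2)] \<gamma>(1)]
  obtain us where us: "us \<in> \<gamma>" using circuit_nonempty[OF mg circ] .
  have v: "v \<in> circuit_verts F \<gamma>" using \<gamma> h unfolding circuit_verts_def by auto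
  then have "card {i. i < length us \<and> vert F (us ! i) = v} = 2"
    using euler_visits[OF assms \<gamma>(1) us, of v] by simp
  then obtain m where m: "m < length us" "vert F (us ! m) = v" by (auto simp: card_2_iff)
  define ws where "ws = rotate m us"
  have ws: "ws \<in> \<gamma>" unfolding ws_def by (rule circuit_rotate[OF mg circ us])
  have "0 < length us" using m by auto
  then have "us ! m = ws ! 0" "0 < length ws"
    using m unfolding ws_def by (simp_all add: nth_rotate)
  then have zero: "0 \<in> {i. i < length ws \<and> vert F (ws ! i) = v}" using m by simp
  moreover have "card {i. i < length ws \<and> vert F (ws ! i) = v} = 2"
    using euler_visits[OF assms \<gamma>(1) ws, of v] v by simp
  moreover from this obtain y z where "{i. i < length ws \<and> vert F (ws ! i) = v} = {y, z}" "y \<noteq> z"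
    by (auto simp only: card_2_iff)
  ultimately obtain k where "k \<noteq> 0" "{i. i < length ws \<and> vert F (ws ! i) = v} = {0, k}"
    by (metis insertE insert_commute singletonD)
  then have "tour_from F C v ws k"
    using \<gamma>(1) ws unfolding tour_from_def by blast
  then show ?thesis using that by blast
qed

lemma tour_halves:
  assumes "four_regular F" "euler_system F C" "tour_from F C v ws k"
  defines "a \<equiv> opp F (ws ! (length ws - 1))" and "b \<equiv> ws ! 0"
    and "c \<equiv> opp F (ws ! (k - 1))" and "d \<equiv> ws ! k"
  shows "in_halves F ws v = {a, c}" "out_halves F ws v = {b, d}"
    "halves_at F v = {a, b, c, d}" "distinct [a, b, c, d]"
    "transition_at F C v = {{a, b}, {c, d}}"
proof -
  note mg = four_regular_multigraph[OF assms(1)]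
  obtain \<gamma> where \<gamma>: "\<gamma> \<in> C" "ws \<in> \<gamma>" using assms(3) unfolding tour_from_def by auto
  note part = euler_partition[OF assms(2)]
  note circ = circuit_partition_circuits[OF part \<gamma>(1)]
  note trail = circuit_closed_trail[OF mg circ \<gamma>(2)]
  have k: "0 < k" "k < length ws"
    and v: "\<And>i. i < length ws \<Longrightarrow> vert F (ws ! i) = v \<longleftrightarrow> i = 0 \<or> i = k"
    using assms(3) unfolding tour_from_def by auto
  have last: "Suc (length ws - 1) = length ws" "length ws - 1 < length ws" using k by simp_all
  show out: "out_halves F ws v = {b, d}"
    using k v unfolding out_halves_def b_def d_def in_set_conv_nth by force
  have head: "vert F (opp F (ws ! i)) = v \<longleftrightarrow> i = length ws - 1 \<or> i = k - 1" if i: "i < length ws" for i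
  proof (cases "Suc i < length ws")
    case True
    then show ?thesis using closed_trail_step[OF trail i] v[OF True] k by auto
  next
    case False
    then have "Suc i = length ws" using i by simp
    moreover have "vert F (ws ! 0) = v" using v[of 0] k by linarith
    moreover have "i = length ws - 1" using \<open>Suc i = length ws\<close> by simp
    ultimately show ?thesis using closed_trail_step[OF trail i] by simp
  qed
  have "in_halves F ws v = {opp F (ws ! i) | i. i < length ws \<and> vert F (opp F (ws ! i)) = v}"
    unfolding in_halves_def by (force simp: in_set_conv_nth)
  also have "\<dots> = {opp F (ws ! i) | i. i = length ws - 1 \<or> i = k - 1}"
    using head k by (intro Collect_cong) (metis last(2) less_imp_diff_less)
  finally show ins: "in_halves F ws v = {a, c}" unfolding a_def c_def by auto
  have "ws ! 0 \<in> set ws" using k by (intro nth_mem) auto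
  then have "ws ! 0 \<in> circuit_halves \<gamma>" using circuit_halves_eq[OF mg circ \<gamma>(2)] by auto
  then have "v \<in> circuit_verts F \<gamma>" unfolding circuit_verts_def using v[of 0] k by force
  then show at: "halves_at F v = {a, b, c, d}"
    using euler_halves_at[OF mg assms(2) \<gamma>(1)] circuit_halves_at[OF mg circ \<gamma>(2), of v] ins out
    by auto
  have "card (halves_at F v) = 4" using assms(1) unfolding four_regular_def by blast
  then have "card (set [a, b, c, d]) = length [a, b, c, d]" unfolding at by simp
  then show dist: "distinct [a, b, c, d]" by (rule card_distinct)
  have "vert F (ws ! 0) = v" using v[of 0] k by linarith
  then have ab: "{a, b} \<in> transition_at F C v"
    using pass_in_transition[OF mg part \<gamma> last(2)] last unfolding a_def b_def by simp
  have "{a, b} \<notin> {{a, c}, {b, d}}" "{a, b} \<notin> {{a, d}, {b, c}}"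
    using dist by (simp_all add: doubleton_eq_iff)
  with ab have "{{a, c}, {b, d}} \<noteq> transition_at F C v" "{{a, d}, {b, c}} \<noteq> transition_at F C v"
    by metis+
  then show "transition_at F C v = {{a, b}, {c, d}}"
    using transition_cases[OF transition_at_mem[OF part] at dist] by metis
qed

text \<open>
  The labels read off a tour, where \<open>a\<close>, \<open>c\<close> enter \<open>v\<close> and are followed by \<open>b\<close>, \<open>d\<close>.
\<close>

lemma tour_labels:
  assumes "four_regular F" "euler_system F C" "tour_from F C v ws k" "T \<in> transitions F v"
  defines "a \<equiv> opp F (ws ! (length ws - 1))" and "b \<equiv> ws ! 0"
    and "c \<equiv> opp F (ws ! (k - 1))" and "d \<equiv> ws ! k"
  shows "phi_labeled F C v T \<longleftrightarrow> T = {{a, b}, {c, d}}"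
    "chi_labeled F C v T \<longleftrightarrow> T = {{a, d}, {b, c}}"
    "psi_labeled F C v T \<longleftrightarrow> T = {{a, c}, {b, d}}"
proof -
  note mg = four_regular_multigraph[OF assms(1)]
  note tour = tour_halves[OF assms(1-3), folded a_def b_def c_def d_def]
  note part = euler_partition[OF assms(2)]
  show phi: "phi_labeled F C v T \<longleftrightarrow> T = {{a, b}, {c, d}}"
    unfolding phi_labeled_def tour(5) ..
  obtain \<gamma> where \<gamma>: "\<gamma> \<in> C" "ws \<in> \<gamma>" using assms(3) unfolding tour_from_def by auto
  note circ = circuit_partition_circuits[OF part \<gamma>(1)]
  have v: "v \<in> circuit_verts F \<gamma>"
    using circuit_halves_at[OF mg circ \<gamma>(2), of v] tour(2)
    unfolding circuit_verts_def halves_at_def by auto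
  have io: "in_halves F ws' v = {a, c} \<and> out_halves F ws' v = {b, d} \<or>
      in_halves F ws' v = {b, d} \<and> out_halves F ws' v = {a, c}"
    if "\<delta> \<in> C" "v \<in> circuit_verts F \<delta>" "ws' \<in> \<delta>" for \<delta> ws'
  proof -
    have "\<delta> = \<gamma>" by (rule euler_unique_circuit_at[OF mg assms(2) that(1) \<gamma>(1) that(2) v])
    then have "ws' \<in> \<gamma>" using that by simp
    moreover have "set ws \<subseteq> halves F"
      using circuit_closed_trail[OF mg circ \<gamma>(2)] unfolding closed_trail_def by auto
    ultimately have "set ws' = set ws \<or> set ws' = opp F ` set ws \<and> opp F ` set ws' = set ws"
      using circuit_set_cases[OF mg circ \<gamma>(2)] opp_image_opp[OF mg] by metis
    then consider "set ws' = set ws" | "set ws' = opp F ` set ws" "opp F ` set ws' = set ws"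
      by blast
    then show ?thesis
    proof cases
      case 1
      then have "in_halves F ws' v = in_halves F ws v" "out_halves F ws' v = out_halves F ws v"
        unfolding in_halves_def out_halves_def by simp_all
      then show ?thesis using tour(1,2) by simp
    next
      case 2
      then have "in_halves F ws' v = out_halves F ws v" "out_halves F ws' v = in_halves F ws v"
        unfolding in_halves_def out_halves_def by simp_all
      then show ?thesis using tour(1,2) by simp
    qed
  qed
  note cases = transition_cases[OF assms(4) tour(3,4)]
  show "chi_labeled F C v T \<longleftrightarrow> T = {{a, d}, {b, c}}"
  proof
    assume "chi_labeled F C v T"
    then obtain \<delta> ws' where \<delta>: "\<delta> \<in> C" "v \<in> circuit_verts F \<delta>" "ws' \<in> \<delta>"
      and cross: "\<forall>p\<in>T. \<exists>a'\<in>in_halves F ws' v. \<exists>b'\<in>out_halves F ws' v. p = {a', b'}"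
      and not_phi: "T \<noteq> transition_at F C v"
      unfolding chi_labeled_def by blast
    have "{a, c} \<notin> T" using cross io[OF \<delta>] tour(4) by (auto simp: doubleton_eq_iff)
    then have "T \<noteq> {{a, c}, {b, d}}" by blast
    then show "T = {{a, d}, {b, c}}" using cases not_phi tour(5) by metis
  next
    assume T: "T = {{a, d}, {b, c}}"
    have "T \<noteq> transition_at F C v" unfolding T tour(5) using tour(4) by (auto simp: doubleton_eq_iff)
    moreover have "\<forall>p\<in>T. \<exists>a'\<in>in_halves F ws v. \<exists>b'\<in>out_halves F ws v. p = {a', b'}"
      unfolding T tour(1,2) by auto
    ultimately show "chi_labeled F C v T"
      unfolding chi_labeled_def using assms(4) \<gamma> v by blast
  qed
  show "psi_labeled F C v T \<longleftrightarrow> T = {{a, c}, {b, d}}"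
  proof
    assume "psi_labeled F C v T"
    then obtain \<delta> ws' where \<delta>: "\<delta> \<in> C" "v \<in> circuit_verts F \<delta>" "ws' \<in> \<delta>"
      and "T = {in_halves F ws' v, out_halves F ws' v}"
      unfolding psi_labeled_def by blast
    then show "T = {{a, c}, {b, d}}" using io[OF \<delta>] by auto
  next
    assume "T = {{a, c}, {b, d}}"
    then show "psi_labeled F C v T"
      unfolding psi_labeled_def using assms(4) \<gamma> v tour(1,2) by blast
  qed
qed

text \<open>
  Another vertex is visited twice or not at all, so it is interlaced with \<open>v\<close> if and only if the
  number of its visits before the return to \<open>v\<close> is odd.
\<close>

lemma tour_interlaced:
  assumes "four_regular F" "euler_system F C" "tour_from F C v ws k" "w \<noteq> v"
  shows "interlaced F C v w \<longleftrightarrow> odd (card {m \<in> {0<..<k}. vert F (ws ! m) = w})"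
proof -
  note mg = four_regular_multigraph[OF assms(1)]
  note part = euler_partition[OF assms(2)]
  obtain \<gamma> where \<gamma>: "\<gamma> \<in> C" "ws \<in> \<gamma>" using assms(3) unfolding tour_from_def by auto
  note circ = circuit_partition_circuits[OF part \<gamma>(1)]
  have k: "0 < k" "k < length ws"
    and v: "\<And>i. i < length ws \<Longrightarrow> vert F (ws ! i) = v \<longleftrightarrow> i = 0 \<or> i = k"
    using assms(3) unfolding tour_from_def by auto
  define N where "N = {i. i < length ws \<and> vert F (ws ! i) = w}"
  define M where "M = {m \<in> {0<..<k}. vert F (ws ! m) = w}"
  have N: "card N = 0 \<or> card N = 2" "finite N"
    unfolding N_def using euler_visits[OF assms(1,2) \<gamma>, of w] by auto
  have MN: "M \<subseteq> N" unfolding M_def N_def using k by auto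
  have "odd (card M)" if "interlaced F C v w"
  proof -
    obtain \<delta> us i j k' l where \<delta>: "\<delta> \<in> C" "us \<in> \<delta>"
      and idx: "i < j" "j < k'" "k' < l" "l < length us"
      and pat: "vert F (us ! i) = v" "vert F (us ! j) = w" "vert F (us ! k') = v" "vert F (us ! l) = w"
      using \<open>interlaced F C v w\<close> unfolding interlaced_def by blast
    have "us ! i \<in> circuit_halves \<delta>"
      using circuit_halves_eq[OF mg circuit_partition_circuits[OF part \<delta>(1)] \<delta>(2)] idx by auto
    then have "v \<in> circuit_verts F \<delta>" using pat(1) unfolding circuit_verts_def by blast
    moreover have "ws ! 0 \<in> set ws" using k by (intro nth_mem) auto
    then have "ws ! 0 \<in> circuit_halves \<gamma>" using circuit_halves_eq[OF mg circ \<gamma>(2)] by auto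
    moreover have "vert F (ws ! 0) = v" using v[of 0] k by linarith
    ultimately have "v \<in> circuit_verts F \<delta>" "v \<in> circuit_verts F \<gamma>"
      unfolding circuit_verts_def by (blast, metis imageI)
    then have "\<delta> = \<gamma>"
      by (rule euler_unique_circuit_at[OF mg assms(2) \<delta>(1) \<gamma>(1)])
    then have us: "us \<in> \<gamma>" using \<delta> by simp
    have "alternating (map (vert F) us) v w"
      by (rule alternatingI[of v w _ _ i j k' l]) (use idx pat in auto)
    then have "alternating (map (vert F) ws) v w"
      using circuit_alternating[OF mg circ us \<gamma>(2)] by simp
    then obtain a b i j k' l where ab: "{a, b} = {v, w}"
      and idx: "i < j" "j < k'" "k' < l" "l < length ws"
      and pat: "vert F (ws ! i) = a" "vert F (ws ! j) = b" "vert F (ws ! k') = a" "vert F (ws ! l) = b"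
      unfolding alternating_def by auto
    have "a = v \<and> b = w"
    proof (rule ccontr)
      assume "\<not> (a = v \<and> b = w)"
      then have "b = v" using ab by (auto simp: doubleton_eq_iff)
      then have "j = 0 \<or> j = k" "l = 0 \<or> l = k" using v[of j] v[of l] pat idx by auto
      then show False using idx by auto
    qed
    then have ab: "a = v" "b = w" by auto
    then have "i = 0 \<or> i = k" "k' = 0 \<or> k' = k" using v[of i] v[of k'] pat idx by auto
    then have i: "i = 0" "k' = k" using idx by auto
    have jl: "{j, l} \<subseteq> N" unfolding N_def using pat idx ab by auto
    have "card {j, l} = 2" using idx by auto
    then have "card {j, l} = card N" using N card_mono[OF N(2) jl] by auto
    then have "N = {j, l}" using card_subset_eq[OF N(2) jl] by simp
    moreover have "j \<in> M" "l \<notin> M" using idx i pat ab unfolding M_def by auto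
    ultimately have "M = {j}" using MN by blast
    then show ?thesis by simp
  qed
  moreover have "interlaced F C v w" if odd: "odd (card M)"
  proof -
    have le: "card M \<le> card N" by (rule card_mono[OF N(2) MN])
    then have "card M = 1" "card N = 2" using odd N(1) by (auto elim!: oddE)
    then obtain j where j: "M = {j}" by (auto simp: card_1_singleton_iff)
    then obtain l where l: "N = {j, l}" "l \<noteq> j"
      using \<open>card N = 2\<close> MN by (auto simp: card_2_iff)
    have lN: "l < length ws" "vert F (ws ! l) = w" using l unfolding N_def by auto
    have "l \<notin> M" using j l by auto
    moreover have "l \<noteq> 0" "l \<noteq> k" using lN v[OF lN(1)] assms(4) by auto
    ultimately have "k < l" using lN unfolding M_def by auto
    moreover have "0 < j" "j < k" "vert F (ws ! j) = w" using j unfolding M_def by auto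
    moreover have "vert F (ws ! 0) = v" "vert F (ws ! k) = v" using v[of 0] v[of k] k by linarith+
    ultimately show ?thesis
      using \<gamma> lN assms(4) unfolding interlaced_def by blast
  qed
  ultimately show ?thesis unfolding M_def by blast
qed

text \<open>
  Between its two visits to \<open>v\<close>, the labelling collects the entries of \<open>x\<close> at the vertices
  interlaced with \<open>v\<close>.
\<close>

lemma tour_jumps:
  assumes "four_regular F" "euler_system F C" "tour_from F C v ws k" "jumps F C x f"
  defines "a \<equiv> opp F (ws ! (length ws - 1))" and "b \<equiv> ws ! 0"
    and "c \<equiv> opp F (ws ! (k - 1))" and "d \<equiv> ws ! k"
  shows "f b = f a + x $ v" "f d = f c + x $ v"
    "f c = f b + (\<Sum>w\<in>UNIV. interlacement_matrix F C $ v $ w * x $ w)"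
proof -
  note mg = four_regular_multigraph[OF assms(1)]
  note part = euler_partition[OF assms(2)]
  note tour = tour_halves[OF assms(1-3), folded a_def b_def c_def d_def]
  have jump: "f h' = f h + x $ v" if "{h, h'} \<in> transition_at F C v" "h \<noteq> h'" for h h'
    by (rule jumpsD[OF assms(4) that(1) _ _ that(2)]) simp_all
  show "f b = f a + x $ v" "f d = f c + x $ v"
    using jump[of a b] jump[of c d] tour(4,5) by simp_all
  obtain \<gamma> where \<gamma>: "\<gamma> \<in> C" "ws \<in> \<gamma>" using assms(3) unfolding tour_from_def by auto
  note trail = circuit_closed_trail[OF mg circuit_partition_circuits[OF part \<gamma>(1)] \<gamma>(2)]
  have k: "0 < k" "k < length ws"
    and v: "\<And>i. i < length ws \<Longrightarrow> vert F (ws ! i) = v \<longleftrightarrow> i = 0 \<or> i = k"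
    using assms(3) unfolding tour_from_def by auto
  have "f c = f (ws ! (k - 1))"
    using jumps_opp[OF assms(4) closed_trail_nth_in[OF trail, of "k - 1"]] k unfolding c_def by simp
  also have "\<dots> = f b + (\<Sum>m\<in>{0<..k - 1}. x $ (vert F (ws ! m)))"
    unfolding b_def by (rule jumps_along[OF mg part assms(4) \<gamma>]) (use k in auto)
  also have "{0<..k - 1} = {0<..<k}" using k by auto
  also have "(\<Sum>m\<in>{0<..<k}. x $ (vert F (ws ! m))) =
      (\<Sum>w\<in>UNIV. of_bool (odd (card {m \<in> {0<..<k}. vert F (ws ! m) = w})) * x $ w)"
    by (rule sum_bit_by_fibres) simp
  also have "\<dots> = (\<Sum>w\<in>UNIV. interlacement_matrix F C $ v $ w * x $ w)"
  proof (rule sum.cong[OF refl])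
    fix w
    show "of_bool (odd (card {m \<in> {0<..<k}. vert F (ws ! m) = w})) * x $ w =
        interlacement_matrix F C $ v $ w * x $ w"
    proof (cases "w = v")
      case True
      have "{m \<in> {0<..<k}. vert F (ws ! m) = v} = {}" using v k by auto
      then have "even (card {m \<in> {0<..<k}. vert F (ws ! m) = v})" by (simp only: card.empty even_zero)
      moreover have "\<not> interlaced F C v v" unfolding interlaced_def by simp
      ultimately show ?thesis
        unfolding True interlacement_matrix_def by (simp del: greaterThanLessThan_iff)
    next
      case False
      show ?thesis
        using tour_interlaced[OF assms(1-3) False] by (simp add: interlacement_matrix_def)
    qed
  qed
  finally show "f c = f b + (\<Sum>w\<in>UNIV. interlacement_matrix F C $ v $ w * x $ w)" .
qed

text \<open>
  Every vector is the jump vector of a labelling: each Euler circuit visits every one of its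
  vertices twice, so the jumps cancel by the time the circuit closes.
\<close>

lemma jumps_exist:
  assumes "four_regular F" "euler_system F C"
  obtains f where "jumps F C x f"
proof -
  note mg = four_regular_multigraph[OF assms(1)]
  note part = euler_partition[OF assms(2)]
  note circ = circuit_partition_circuits[OF part]
  define r where "r \<gamma> = (SOME ws. ws \<in> \<gamma>)" for \<gamma> :: "'b list set"
  have r: "r \<gamma> \<in> \<gamma>" if "\<gamma> \<in> C" for \<gamma>
    using circuit_nonempty[OF mg circ[OF that]] unfolding r_def by (metis someI)
  have trail: "closed_trail F (r \<gamma>)" if "\<gamma> \<in> C" for \<gamma>
    by (rule circuit_closed_trail[OF mg circ r]) (use that in auto)
  have halves: "circuit_halves \<gamma> = set (r \<gamma>) \<union> opp F ` set (r \<gamma>)" if "\<gamma> \<in> C" for \<gamma>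
    by (rule circuit_halves_eq[OF mg circ r]) (use that in auto)
  \<comment> \<open>The label of the \<open>j\<close>-th edge of the chosen representative \<open>r \<gamma>\<close> is the sum \<open>S \<gamma> j\<close> of the entries
    met so far. Each edge occurs exactly once in the chosen representatives, so that \<open>S\<close> can be
    transported to edges.\<close>
  define S where "S \<gamma> j = (\<Sum>m\<le>j. x $ vert F (r \<gamma> ! m))" for \<gamma> and j :: nat
  let ?A = "SIGMA \<gamma>:C. {..<length (r \<gamma>)}"
  define e where "e = (\<lambda>(\<gamma>, j). full_edge F (r \<gamma> ! j))"
  have inj: "inj_on e ?A"
  proof (rule inj_onI)
    fix s t assume "s \<in> ?A" "t \<in> ?A" "e s = e t"
    then obtain \<gamma> i \<delta> j where st: "s = (\<gamma>, i)" "t = (\<delta>, j)" "\<gamma> \<in> C" "\<delta> \<in> C"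
      "i < length (r \<gamma>)" "j < length (r \<delta>)" "full_edge F (r \<gamma> ! i) = full_edge F (r \<delta> ! j)"
      unfolding e_def by auto
    have h: "r \<gamma> ! i \<in> halves F" "r \<delta> ! j \<in> halves F"
      using closed_trail_nth_in[OF trail] st by auto
    have "r \<delta> ! j = r \<gamma> ! i \<or> r \<delta> ! j = opp F (r \<gamma> ! i)"
      using full_edge_eq_iff[OF mg h] st by simp
    then have "r \<delta> ! j \<in> circuit_halves \<gamma>" "r \<delta> ! j \<in> circuit_halves \<delta>"
      using halves[OF st(3)] halves[OF st(4)] st(5,6) by auto
    then have "\<gamma> = \<delta>" using circuit_partition_unique[OF mg part st(3,4)] by blast
    moreover from this have "i = j"
      using closed_trail_edge_inj[OF trail[OF st(3)]] st by auto
    ultimately show "s = t" using st by simp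
  qed
  define f where "f h = (case inv_into ?A e (full_edge F h) of (\<gamma>, j) \<Rightarrow> S \<gamma> j)" for h
  have f: "f (r \<gamma> ! j) = S \<gamma> j" if "\<gamma> \<in> C" "j < length (r \<gamma>)" for \<gamma> j
    using inv_into_f_f[OF inj, of "(\<gamma>, j)"] that unfolding f_def e_def by simp
  have f_opp: "f (opp F h) = f h" if "h \<in> halves F" for h
    unfolding f_def full_edge_opp[OF mg that] ..
  have total: "(\<Sum>m<length (r \<gamma>). x $ vert F (r \<gamma> ! m)) = 0" if "\<gamma> \<in> C" for \<gamma>
  proof -
    have "(\<Sum>m<length (r \<gamma>). x $ vert F (r \<gamma> ! m)) =
        (\<Sum>w\<in>UNIV. of_bool (odd (card {m \<in> {..<length (r \<gamma>)}. vert F (r \<gamma> ! m) = w})) * x $ w)"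
      by (rule sum_bit_by_fibres) simp
    also have "\<dots> = 0"
      using euler_visits[OF assms that r[OF that]] by (intro sum.neutral) auto
    finally show ?thesis .
  qed
  have step: "f (r \<gamma> ! (Suc i mod length (r \<gamma>))) =
      f (opp F (r \<gamma> ! i)) + x $ (vert F (r \<gamma> ! (Suc i mod length (r \<gamma>))))"
    if \<gamma>: "\<gamma> \<in> C" and i: "i < length (r \<gamma>)" for \<gamma> i
  proof -
    have i_eq: "f (opp F (r \<gamma> ! i)) = S \<gamma> i"
      using f_opp[OF closed_trail_nth_in[OF trail[OF \<gamma>] i]] f[OF \<gamma> i] by simp
    show ?thesis
    proof (cases "Suc i < length (r \<gamma>)")
      case True
      then show ?thesis using f[OF \<gamma> True] i_eq unfolding S_def by simp
    next
      case False
      then have last: "Suc i = length (r \<gamma>)" using i by simp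
      then have "{..i} = {..<length (r \<gamma>)}" by auto
      then have "S \<gamma> i = 0" using total[OF \<gamma>] unfolding S_def by simp
      moreover have "0 < length (r \<gamma>)" using last by linarith
      ultimately show ?thesis using f[OF \<gamma>, of 0] i_eq last unfolding S_def by simp
    qed
  qed
  have "f h' = f h + x $ v" if p: "p \<in> transition_at F C v" and h: "h \<in> p" "h' \<in> p" "h \<noteq> h'" for p v h h'
  proof -
    note T = transition_at_mem[OF part, of v]
    \<comment> \<open>The pass \<open>p\<close> may stem from a representative other than \<open>r \<gamma>\<close>. It equals the pass \<open>?q\<close> of \<open>r \<gamma>\<close>
      below, as only one pair of the transition contains \<open>h\<close>.\<close>
    obtain \<gamma> where \<gamma>: "\<gamma> \<in> C" "p \<subseteq> circuit_halves \<gamma>" using transition_in_circuit[OF mg part p] .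
    obtain i where i: "i < length (r \<gamma>)" "h \<in> {opp F (r \<gamma> ! i), r \<gamma> ! (Suc i mod length (r \<gamma>))}"
    proof -
      have "h \<in> set (r \<gamma>) \<union> opp F ` set (r \<gamma>)" using \<gamma> h(1) halves[OF \<gamma>(1)] by auto
      then consider j where "j < length (r \<gamma>)" "h = opp F (r \<gamma> ! j)" | j where "j < length (r \<gamma>)" "h = r \<gamma> ! j"
        by (auto simp: in_set_conv_nth)
      then show ?thesis
      proof cases
        case 1 then show ?thesis using that[of j] by simp
      next
        case (2 j)
        show ?thesis
        proof (cases j)
          \<comment> \<open>The first half-edge is preceded, cyclically, by the last one.\<close>
          case 0
          then have "Suc (length (r \<gamma>) - 1) = length (r \<gamma>)" "length (r \<gamma>) - 1 < length (r \<gamma>)"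
            using 2 by auto
          then show ?thesis using that[of "length (r \<gamma>) - 1"] 2 0 by simp
        next
          case (Suc m) then show ?thesis using that[of m] 2 by simp
        qed
      qed
    qed
    let ?q = "{opp F (r \<gamma> ! i), r \<gamma> ! (Suc i mod length (r \<gamma>))}"
    have hv: "vert F h = v" using transition_subset[OF T p] h(1) unfolding halves_at_def by auto
    have "vert F (r \<gamma> ! (Suc i mod length (r \<gamma>))) = v"
      using i hv closed_trail_step[OF trail[OF \<gamma>(1)] i(1)] by auto
    moreover from this have "?q \<in> transition_at F C v"
      using pass_in_transition[OF mg part \<gamma>(1) r[OF \<gamma>(1)] i(1)] by simp
    then have "p = ?q" using transition_unique[OF T p _ h(1) i(2)] by blast
    ultimately show ?thesis
      using step[OF \<gamma>(1) i(1)] h by (auto simp: add.assoc bit_add_self)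
  qed
  then have "jumps F C x f" using f_opp by (intro jumpsI)
  then show ?thesis using that by blast
qed


section \<open>The nullspace of the relative interlacement matrix\<close>

lemma labels_trichotomy:
  assumes "four_regular F" "euler_system F C" "T \<in> transitions F v"
  shows "\<not> phi_labeled F C v T \<longleftrightarrow> chi_labeled F C v T \<or> psi_labeled F C v T"
    "\<not> (chi_labeled F C v T \<and> psi_labeled F C v T)"
proof -
  obtain ws k where tour: "tour_from F C v ws k" using tour_exists[OF assms(1,2)] .
  note halves = tour_halves[OF assms(1,2) tour]
  note labels = tour_labels[OF assms(1,2) tour assms(3)]
  note cases = transition_cases[OF assms(3) halves(3,4)]
  show "\<not> phi_labeled F C v T \<longleftrightarrow> chi_labeled F C v T \<or> psi_labeled F C v T"
    "\<not> (chi_labeled F C v T \<and> psi_labeled F C v T)"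
    unfolding labels using cases halves(4) by (auto simp: doubleton_eq_iff)
qed

text \<open>
  Row \<open>v\<close> of the system \<open>\<I>\<^sub>P(C) x = 0\<close> says that the labelling with jump vector \<open>x\<close> along \<open>C\<close> is
  constant on the two pairs of half-edges into which \<open>P\<close> sorts the half-edges at \<open>v\<close>.
\<close>

lemma row_eq_0_iff:
  assumes "four_regular F" "circuit_partition F P" "euler_system F C" "jumps F C x f"
    and x_phi: "\<And>w. phi_labeled F C w (transition_at F P w) \<Longrightarrow> x $ w = 0"
  shows "(relative_interlacement_matrix F P C *v x) $ v = 0 \<longleftrightarrow>
    (\<forall>p\<in>transition_at F P v. \<forall>h\<in>p. \<forall>h'\<in>p. f h' = f h)"
proof -
  let ?T = "\<lambda>w. transition_at F P w" and ?I = "interlacement_matrix F C"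
  note T = transition_at_mem[OF assms(2), of v]
  obtain ws k where tour: "tour_from F C v ws k" using tour_exists[OF assms(1,3)] .
  define a b c d where abcd: "a = opp F (ws ! (length ws - 1))" "b = ws ! 0"
    "c = opp F (ws ! (k - 1))" "d = ws ! k"
  note halves = tour_halves[OF assms(1,3) tour, folded abcd]
  note labels = tour_labels[OF assms(1,3) tour T, folded abcd]
  note jump = tour_jumps[OF assms(1,3) tour assms(4), folded abcd]
  have row: "(relative_interlacement_matrix F P C *v x) $ v =
      (\<Sum>w\<in>UNIV. relative_interlacement_matrix F P C $ v $ w * x $ w)"
    by (simp add: matrix_vector_mult_def)
  have diag: "?I $ v $ v = 0"
    by (simp add: interlacement_matrix_def interlaced_def)
  consider "phi_labeled F C v (?T v)" | "chi_labeled F C v (?T v)" | "psi_labeled F C v (?T v)"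
    using labels_trichotomy(1)[OF assms(1,3) T] by blast
  then show ?thesis
  proof cases
    case 1
    have "relative_interlacement_matrix F P C $ v $ w * x $ w = 0" for w
      using 1 x_phi[OF 1] by (auto simp: relative_interlacement_matrix_def)
    then have "(relative_interlacement_matrix F P C *v x) $ v = 0"
      unfolding row by (rule sum.neutral[OF ballI])
    moreover have "f b = f a" "f d = f c" using jump x_phi[OF 1] by simp_all
    ultimately show ?thesis using 1 labels(1) by auto
  next
    \<comment> \<open>\<open>P\<close> has the pairs \<open>{a, d}\<close> and \<open>{b, c}\<close>, and the row of \<open>v\<close> evaluates to \<open>f b + f c\<close>.\<close>
    case 2
    have not: "\<not> phi_labeled F C v (?T v)" "\<not> psi_labeled F C v (?T v)"
      using 2 labels_trichotomy[OF assms(1,3) T] by auto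
    have "relative_interlacement_matrix F P C $ v $ w * x $ w = ?I $ v $ w * x $ w" for w
      using not x_phi by (auto simp: relative_interlacement_matrix_def)
    then have "(relative_interlacement_matrix F P C *v x) $ v = (\<Sum>w\<in>UNIV. ?I $ v $ w * x $ w)"
      unfolding row by (intro sum.cong) auto
    also have "\<dots> = f b + f c"
      unfolding jump(3) by (simp add: bit_add_self flip: add.assoc)
    finally have "(relative_interlacement_matrix F P C *v x) $ v = 0 \<longleftrightarrow> f b = f c"
      by (simp add: bit_add_eq_0_iff)
    moreover have "f a = f d" if "f b = f c"
      using jump(1,2) that by (simp add: add.assoc bit_add_self)
    ultimately show ?thesis using 2 labels(2) by auto
  next
    \<comment> \<open>\<open>P\<close> has the pairs \<open>{a, c}\<close> and \<open>{b, d}\<close>, and the row of \<open>v\<close> evaluates to \<open>f a + f c\<close>.\<close>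
    case 3
    have not: "\<not> phi_labeled F C v (?T v)" using 3 labels_trichotomy[OF assms(1,3) T] by auto
    have "relative_interlacement_matrix F P C $ v $ w * x $ w =
        ?I $ v $ w * x $ w + (if w = v then x $ v else 0)" for w
      using not 3 x_phi diag by (auto simp: relative_interlacement_matrix_def)
    then have "(relative_interlacement_matrix F P C *v x) $ v =
        (\<Sum>w\<in>UNIV. ?I $ v $ w * x $ w) + x $ v"
      unfolding row by (simp add: sum.distrib)
    also have "\<dots> = f a + f c"
    proof -
      have "f c = f a + ((\<Sum>w\<in>UNIV. ?I $ v $ w * x $ w) + x $ v)"
        using jump(1,3) by (simp add: ac_simps)
      then show ?thesis by (simp add: bit_add_self flip: add.assoc)
    qed
    finally have "(relative_interlacement_matrix F P C *v x) $ v = 0 \<longleftrightarrow> f a = f c"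
      by (simp add: bit_add_eq_0_iff)
    moreover have "f b = f d" if "f a = f c"
      using jump(1,2) that by simp
    ultimately show ?thesis using 3 labels(3) by auto
  qed
qed

text \<open>
  At a vertex where \<open>P\<close> follows \<open>C\<close>, the matrix has a row of the identity matrix.
\<close>

lemma null_phi:
  assumes "relative_interlacement_matrix F P C *v x = 0" "phi_labeled F C v (transition_at F P v)"
  shows "x $ v = 0"
proof -
  have "relative_interlacement_matrix F P C $ v $ w * x $ w = (if w = v then x $ v else 0)" for w
    using assms(2) by (auto simp: relative_interlacement_matrix_def)
  then have "(relative_interlacement_matrix F P C *v x) $ v = x $ v"
    by (simp add: matrix_vector_mult_def)
  then show ?thesis using assms(1) by simp
qed

lemma null_iff_jumps:
  assumes "four_regular F" "circuit_partition F P" "euler_system F C" "jumps F C x f"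
    and "\<And>w. phi_labeled F C w (transition_at F P w) \<Longrightarrow> x $ w = 0"
  shows "relative_interlacement_matrix F P C *v x = 0 \<longleftrightarrow> jumps F P 0 f"
proof -
  have "jumps F P 0 f \<longleftrightarrow> (\<forall>v. \<forall>p\<in>transition_at F P v. \<forall>h\<in>p. \<forall>h'\<in>p. f h' = f h)"
    (is "_ \<longleftrightarrow> ?const")
  proof
    assume f: "jumps F P 0 f"
    show ?const
    proof (intro allI ballI)
      fix v p h h' assume "p \<in> transition_at F P v" "h \<in> p" "h' \<in> p"
      then have "h \<noteq> h' \<Longrightarrow> f h' = f h + 0 $ v" by (rule jumpsD[OF f])
      then show "f h' = f h" by auto
    qed
  next
    assume const: ?const
    show "jumps F P 0 f"
    proof (rule jumpsI)
      show "f (opp F h) = f h" if "h \<in> halves F" for h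
        by (rule jumps_opp[OF assms(4) that])
      show "f h' = f h + 0 $ v"
        if "p \<in> transition_at F P v" "h \<in> p" "h' \<in> p" for v p h h'
        using const[rule_format, OF that] by simp
    qed
  qed
  then show ?thesis
    using row_eq_0_iff[OF assms] by (simp add: vec_eq_iff)
qed

text \<open>
  A combination of relative core vectors is the jump vector along \<open>C\<close> of the labelling that gives
  the half-edges of each circuit of \<open>P\<close> its coefficient.
\<close>

lemma core_combination:
  fixes c :: "'h list set \<Rightarrow> bit"
  assumes "four_regular F" "circuit_partition F P" "euler_system F C"
  defines "x \<equiv> \<Sum>\<gamma>\<in>P. c \<gamma> *s relative_core_vector F P C \<gamma>"
  shows "jumps F C x (\<lambda>h. c (circuit_through P h))"
    and "phi_labeled F C v (transition_at F P v) \<Longrightarrow> x $ v = 0"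
proof -
  note mg = four_regular_multigraph[OF assms(1)]
  let ?f = "\<lambda>h. c (circuit_through P h)"
  note f = jumps_0I[OF mg assms(2), of c]
  have x_phi: "x $ v = 0" if "phi_labeled F C v (transition_at F P v)" for v
    using that labels_trichotomy(1)[OF assms(1,3) transition_at_mem[OF assms(2)], of v]
    unfolding x_def relative_core_vector_def by simp
  then show "phi_labeled F C v (transition_at F P v) \<Longrightarrow> x $ v = 0" .
  have x_eq: "x $ v = ?f h + ?f h'"
    if not_phi: "\<not> phi_labeled F C v (transition_at F P v)"
      and pq: "transition_at F P v = {p, q}" "p \<noteq> q" "h \<in> p" "h' \<in> q" for v p q h h'
  proof -
    have "chi_labeled F C v (transition_at F P v) \<or> psi_labeled F C v (transition_at F P v)"
      using labels_trichotomy(1)[OF assms(1,3) transition_at_mem[OF assms(2)]] not_phi by blast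
    then have "x $ v = (\<Sum>\<gamma>\<in>P. c \<gamma> * of_bool (card (circuit_halves \<gamma> \<inter> halves_at F v) = 2))"
      unfolding x_def relative_core_vector_def by (auto intro!: sum.cong)
    then show ?thesis using sum_singly_incident[OF assms(1,2) pq, of c] by simp
  qed
  have const: "?f h = ?f h'" if "p \<in> transition_at F P v" "h \<in> p" "h' \<in> p" for p h h' v
  proof (cases "h = h'")
    case False
    then have "?f h' = ?f h + 0 $ v" by (rule jumpsD[OF f that])
    then show ?thesis by simp
  qed simp
  show "jumps F C x ?f"
  proof (rule jumpsI)
    show "?f (opp F h) = ?f h" if "h \<in> halves F" for h
      by (rule jumps_opp[OF f that])
  next
    fix v p h h'
    assume p: "p \<in> transition_at F C v" and h: "h \<in> p" "h' \<in> p" "h \<noteq> h'"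
    note T = transition_at_mem[OF assms(2), of v]
    note TC = transition_at_mem[OF euler_partition[OF assms(3)], of v]
    show "?f h' = ?f h + x $ v"
    proof (cases "phi_labeled F C v (transition_at F P v)")
      case True
      then have "p \<in> transition_at F P v" using p unfolding phi_labeled_def by simp
      then show ?thesis using const[of p v h h'] h x_phi[OF True] by simp
    next
      case False
      \<comment> \<open>Two half-edges paired by \<open>C\<close> lie in different pairs of \<open>P\<close>, as \<open>P\<close> does not follow \<open>C\<close>.\<close>
      obtain ws k where tour: "tour_from F C v ws k" using tour_exists[OF assms(1,3)] .
      define a b c' d where abcd: "a = opp F (ws ! (length ws - 1))" "b = ws ! 0"
        "c' = opp F (ws ! (k - 1))" "d = ws ! k"
      note halves = tour_halves[OF assms(1,3) tour, folded abcd]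
      have "transition_at F P v \<noteq> {{a, b}, {c', d}}"
        using False unfolding phi_labeled_def halves(5) .
      then have cases: "transition_at F P v = {{a, c'}, {b, d}} \<or>
          transition_at F P v = {{a, d}, {b, c'}}"
        using transition_cases[OF T halves(3,4)] by metis
      have hh: "h \<in> {a, b} \<and> h' \<in> {a, b} \<or> h \<in> {c', d} \<and> h' \<in> {c', d}"
        using p h unfolding halves(5) by blast
      have sum: "x $ v = ?f h + ?f h'"
        using cases
      proof
        assume tr: "transition_at F P v = {{a, c'}, {b, d}}"
        have "{a, c'} \<noteq> {b, d}" using halves(4) by (auto simp: doubleton_eq_iff)
        note * = x_eq[OF False tr this]
        consider "h \<in> {a, c'}" "h' \<in> {b, d}" | "h' \<in> {a, c'}" "h \<in> {b, d}"
          using hh h(3) by blast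
        then show ?thesis by cases (simp_all add: * add.commute)
      next
        assume tr: "transition_at F P v = {{a, d}, {b, c'}}"
        have "{a, d} \<noteq> {b, c'}" using halves(4) by (auto simp: doubleton_eq_iff)
        note * = x_eq[OF False tr this]
        consider "h \<in> {a, d}" "h' \<in> {b, c'}" | "h' \<in> {a, d}" "h \<in> {b, c'}"
          using hh h(3) by blast
        then show ?thesis by cases (simp_all add: * add.commute)
      qed
      show ?thesis unfolding sum by (simp add: bit_add_self flip: add.assoc)
    qed
  qed
qed

lemma jump_vector_unique:
  assumes "four_regular F" "circuit_partition F C" "jumps F C x f" "jumps F C y f"
  shows "x = y"
  unfolding vec_eq_iff
proof
  fix v
  note T = transition_at_mem[OF assms(2), of v]
  obtain p q where "transition_at F C v = {p, q}" "card p = 2"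
    using transition_two_pairs[OF assms(1) T] .
  then obtain h h' where h: "h \<noteq> h'" "{h, h'} \<in> transition_at F C v" by (auto simp: card_2_iff)
  have "f h' = f h + x $ v"
    by (rule jumpsD[OF assms(3) h(2) _ _ h(1)]) simp_all
  moreover have "f h' = f h + y $ v"
    by (rule jumpsD[OF assms(4) h(2) _ _ h(1)]) simp_all
  ultimately show "x $ v = y $ v" by simp
qed

lemma nullspace_eq_span:
  assumes "four_regular F" "circuit_partition F P" "euler_system F C"
  shows "{x. relative_interlacement_matrix F P C *v x = 0} =
    vec.span (relative_core_vector F P C ` P)"
proof
  note mg = four_regular_multigraph[OF assms(1)]
  note fin = circuit_partition_finite[OF mg assms(2)]
  show "{x. relative_interlacement_matrix F P C *v x = 0} \<subseteq> vec.span (relative_core_vector F P C ` P)"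
  proof
    fix x assume "x \<in> {x. relative_interlacement_matrix F P C *v x = 0}"
    then have null: "relative_interlacement_matrix F P C *v x = 0" by simp
    obtain f where f: "jumps F C x f" using jumps_exist[OF assms(1,3)] .
    have f0: "jumps F P 0 f"
      using null_iff_jumps[OF assms f] null null_phi[OF null] by blast
    define c where "c \<gamma> = f (SOME h. h \<in> circuit_halves \<gamma>)" for \<gamma>
    let ?y = "\<Sum>\<gamma>\<in>P. c \<gamma> *s relative_core_vector F P C \<gamma>"
    have c: "c (circuit_through P h) = f h" if "h \<in> halves F" for h
      using jumps_0_constant[OF mg assms(2) f0] circuit_through[OF mg assms(2) that]
      unfolding c_def by (metis someI)
    have "jumps F C ?y f"
    proof (rule jumpsI)
      show "f (opp F h) = f h" if "h \<in> halves F" for h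
        by (rule jumps_opp[OF f that])
      fix v p h h' assume p: "p \<in> transition_at F C v" and h: "h \<in> p" "h' \<in> p" "h \<noteq> h'"
      have "h \<in> halves F" "h' \<in> halves F"
        using transition_subset[OF transition_at_mem[OF euler_partition[OF assms(3)]] p] h
        unfolding halves_at_def by auto
      moreover have "c (circuit_through P h') = c (circuit_through P h) + ?y $ v"
        by (rule jumpsD[OF core_combination(1)[OF assms, of c] p h])
      ultimately show "f h' = f h + ?y $ v" using c by simp
    qed
    then have "x = ?y"
      using jump_vector_unique[OF assms(1) euler_partition[OF assms(3)] f] by blast
    moreover have "?y \<in> vec.span (relative_core_vector F P C ` P)"
      by (intro vec.span_sum vec.span_scale vec.span_base imageI)
    ultimately show "x \<in> vec.span (relative_core_vector F P C ` P)" by simp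
  qed
  show "vec.span (relative_core_vector F P C ` P) \<subseteq> {x. relative_interlacement_matrix F P C *v x = 0}"
  proof (rule vec.span_minimal)
    show "vec.subspace {x. relative_interlacement_matrix F P C *v x = 0}"
      by (rule vec.subspaceI)
        (auto simp: matrix_vector_right_distrib vec.scale matrix_vector_mult_scaleR)
    show "relative_core_vector F P C ` P \<subseteq> {x. relative_interlacement_matrix F P C *v x = 0}"
    proof
      fix y assume "y \<in> relative_core_vector F P C ` P"
      then obtain \<gamma> where \<gamma>: "\<gamma> \<in> P" "y = relative_core_vector F P C \<gamma>" by auto
      define c where "c = (\<lambda>\<delta>. of_bool (\<delta> = \<gamma>) :: bit)"
      have "(\<Sum>\<delta>\<in>P. c \<delta> *s relative_core_vector F P C \<delta>) =
          (\<Sum>\<delta>\<in>P. if \<delta> = \<gamma> then y else 0)"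
        unfolding c_def \<gamma>(2) by (rule sum.cong) auto
      then have y: "(\<Sum>\<delta>\<in>P. c \<delta> *s relative_core_vector F P C \<delta>) = y"
        using fin \<gamma>(1) by simp
      show "y \<in> {x. relative_interlacement_matrix F P C *v x = 0}"
        using null_iff_jumps[OF assms core_combination[OF assms, where c = c]] jumps_0I[OF mg assms(2), of c]
        unfolding y by simp
    qed
  qed
qed

lemma component_sum_eq_0:
  assumes "four_regular F" "circuit_partition F P" "euler_system F C" "K \<in> graph_components F"
  shows "(\<Sum>\<gamma>\<in>incident_circuits F P K. relative_core_vector F P C \<gamma>) = 0"
proof -
  note mg = four_regular_multigraph[OF assms(1)]
  note part = euler_partition[OF assms(3)]
  \<comment> \<open>With these coefficients, the labelling is the indicator of \<open>K\<close>, which has no jumps.\<close>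
  define c where "c = (\<lambda>\<gamma>. of_bool (\<gamma> \<in> incident_circuits F P K) :: bit)"
  let ?x = "\<Sum>\<gamma>\<in>P. c \<gamma> *s relative_core_vector F P C \<gamma>"
  have c: "c (circuit_through P h) = of_bool (vert F h \<in> K)" if "h \<in> halves F" for h
    using circuit_through[OF mg assms(2) that] circuit_in_component[OF mg assms(2,4)]
    unfolding c_def by simp
  have "jumps F C 0 (\<lambda>h. c (circuit_through P h))"
  proof (rule jumpsI)
    show "c (circuit_through P (opp F h)) = c (circuit_through P h)" if "h \<in> halves F" for h
      using c that component_opp[OF mg assms(4)] multigraph_opp[OF mg] by simp
    fix v p h h' assume "p \<in> transition_at F C v" "h \<in> p" "h' \<in> p"
    then have "h \<in> halves_at F v" "h' \<in> halves_at F v"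
      using transition_subset[OF transition_at_mem[OF part]] by blast+
    then show "c (circuit_through P h') = c (circuit_through P h) + 0 $ v"
      using c unfolding halves_at_def by simp
  qed
  then have "?x = 0"
    using jump_vector_unique[OF assms(1) part core_combination(1)[OF assms(1-3), of c]] by blast
  moreover have "?x = (\<Sum>\<gamma>\<in>P. if \<gamma> \<in> incident_circuits F P K then relative_core_vector F P C \<gamma> else 0)"
    unfolding c_def by (rule sum.cong) auto
  moreover have "P \<inter> incident_circuits F P K = incident_circuits F P K"
    unfolding incident_circuits_def by auto
  ultimately show ?thesis
    using circuit_partition_finite[OF mg assms(2)] by (simp flip: sum.inter_restrict)
qed

lemma core_vectors_independent:
  assumes "four_regular F" "circuit_partition F P" "euler_system F C" "Q \<subseteq> P"
    and no_component: "\<not> (\<exists>K\<in>graph_components F. incident_circuits F P K \<subseteq> Q)"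
    and relation: "(\<Sum>\<gamma>\<in>Q. c \<gamma> *s relative_core_vector F P C \<gamma>) = 0" and "\<gamma> \<in> Q"
  shows "c \<gamma> = 0"
proof (rule ccontr)
  note mg = four_regular_multigraph[OF assms(1)]
  note part = euler_partition[OF assms(3)]
  \<comment> \<open>Extended by \<open>0\<close>, the coefficients give a labelling that has no jumps along \<open>C\<close> either.\<close>
  define c' where "c' = (\<lambda>\<gamma>. if \<gamma> \<in> Q then c \<gamma> else 0)"
  let ?f = "\<lambda>h. c' (circuit_through P h)"
  assume "c \<gamma> \<noteq> 0"
  have "(\<Sum>\<gamma>\<in>P. c' \<gamma> *s relative_core_vector F P C \<gamma>) =
      (\<Sum>\<gamma>\<in>P. if \<gamma> \<in> Q then c \<gamma> *s relative_core_vector F P C \<gamma> else 0)"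
    unfolding c'_def by (rule sum.cong) auto
  also have "\<dots> = 0"
    using relation assms(4) circuit_partition_finite[OF mg assms(2)]
    by (simp add: Int_absorb1 flip: sum.inter_restrict)
  finally have f: "jumps F C 0 ?f"
    using core_combination(1)[OF assms(1-3), of c'] by simp
  have \<gamma>: "\<gamma> \<in> P" using assms by auto
  obtain h where h: "h \<in> circuit_halves \<gamma>"
    using circuit_halves_nonempty[OF mg circuit_partition_circuits[OF assms(2) \<gamma>]] .
  have hF: "h \<in> halves F"
    using h circuit_halves_subset[OF mg circuit_partition_circuits[OF assms(2) \<gamma>]] by auto
  let ?K = "(adjacency F)\<^sup>* `` {vert F h}"
  have "\<delta> \<in> Q" if \<delta>: "\<delta> \<in> incident_circuits F P ?K" for \<delta>
  proof -
    obtain g where g: "\<delta> \<in> P" "g \<in> circuit_halves \<delta>" "vert F g \<in> ?K"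
      using \<delta> unfolding incident_circuits_def circuit_verts_def by auto
    have gF: "g \<in> halves F"
      using g circuit_halves_subset[OF mg circuit_partition_circuits[OF assms(2) g(1)]] by auto
    note th = circuit_through[OF mg part hF] and tg = circuit_through[OF mg part gF]
    \<comment> \<open>The Euler circuit of the component carries both half-edges and has only one value.\<close>
    have "circuit_through C h = circuit_through C g"
      by (rule euler_unique_circuit[OF mg assms(3) component_mem th(1) tg(1) th(2) tg(2)
            in_component g(3)])
    then have "?f h = ?f g"
      using jumps_0_constant[OF mg part f th(1) th(2)] tg(2) by simp
    then have "c' \<gamma> = c' \<delta>"
      using circuit_through_eq[OF mg assms(2) \<gamma> h] circuit_through_eq[OF mg assms(2) g(1,2)] by simp
    then show ?thesis
      using \<open>c \<gamma> \<noteq> 0\<close> assms(7) unfolding c'_def by (auto split: if_splits)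
  qed
  then show False using no_component component_mem[of F "vert F h"] by blast
qed

theorem theorem16:
  fixes F :: "('v::finite, 'h) multigraph"
    and P C :: "'h list set set"
  assumes "four_regular F"
    and "circuit_partition F P"
    and "euler_system F C"
  shows "{x. relative_interlacement_matrix F P C *v x = 0} =
           vec.span (relative_core_vector F P C ` P) \<and>
         (\<forall>K\<in>graph_components F.
           (\<Sum>\<gamma>\<in>incident_circuits F P K. relative_core_vector F P C \<gamma>) = 0) \<and>
         (\<forall>Q. Q \<subseteq> P \<and> \<not> (\<exists>K\<in>graph_components F. incident_circuits F P K \<subseteq> Q) \<longrightarrow>
           (\<forall>c. (\<Sum>\<gamma>\<in>Q. c \<gamma> *s relative_core_vector F P C \<gamma>) = 0 \<longrightarrow> (\<forall>\<gamma>\<in>Q. c \<gamma> = 0)))"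
proof (intro conjI ballI allI impI)
  show "{x. relative_interlacement_matrix F P C *v x = 0} =
      vec.span (relative_core_vector F P C ` P)"
    by (rule nullspace_eq_span[OF assms])
  show "(\<Sum>\<gamma>\<in>incident_circuits F P K. relative_core_vector F P C \<gamma>) = 0"
    if "K \<in> graph_components F" for K
    by (rule component_sum_eq_0[OF assms that])
  show "c \<gamma> = 0"
    if Q: "Q \<subseteq> P \<and> \<not> (\<exists>K\<in>graph_components F. incident_circuits F P K \<subseteq> Q)"
      and c: "(\<Sum>\<gamma>\<in>Q. c \<gamma> *s relative_core_vector F P C \<gamma>) = 0" and "\<gamma> \<in> Q" for Q c \<gamma>
    by (rule core_vectors_independent[OF assms conjunct1[OF Q] conjunct2[OF Q] c \<open>\<gamma> \<in> Q\<close>])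
qed

end
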